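(* Let $\Bbbk$ be an algebraically closed field of characteristic zero. For each of the five pointed non-semisimple Hopf algebras of dimension $8$ (up to isomorphism), namely $\mathcal{A}_2$, $\mathcal{A}_4'$, $\mathcal{A}_4''$, $\mathcal{A}_{4,q}'''$ and $\mathcal{A}_{2,2}$, the partial actions of the Hopf algebra on $\Bbbk$ are exactly the following linear maps (given by their values on the indicated basis), where $\alpha,\beta$ range over arbitrary elements of $\Bbbk$ and $\gamma$ ranges over the elements of $\Bbbk$ with $\gamma^2=-1$. (1) $\mathcal{A}_2$, values on $(1,\,g,\,x,\,y,\,gx,\,gy,\,xy,\,gxy)$: $\varepsilon_{\mathcal{A}_2}=(1,1,0,0,0,0,0,0)$; and $\lambda_{\{1\}}=(1,0,\alpha,\beta,\alpha,\beta,0,0)$. (2) $\mathcal{A}_4'$, values on $(1,\,g,\,g^2,\,g^3,\,x,\,gx,\,g^2x,\,g^3x)$: $\varepsilon_{\mathcal{A}_4'}=(1,1,1,1,0,0,0,0)$; $\lambda_{\{1,g^2\}}=(1,0,1,0,\alpha,\alpha,\alpha,\alpha)$; and $\lambda_{\{1\}}=(1,0,0,0,0,0,0,0)$. (3) $\mathcal{A}_4''$, values on $(1,\,g,\,g^2,\,g^3,\,x,\,gx,\,g^2x,\,g^3x)$: $\varepsilon_{\mathcal{A}_4''}=(1,1,1,1,0,0,0,0)$; $\lambda_{\{1,g^2\}}=(1,0,1,0,\alpha,\alpha,\alpha,\alpha)$; and $\lambda_{\{1\}}=(1,0,0,0,\gamma,0,0,\gamma)$. (4) $\mathcal{A}_{4,q}'''$,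 values on $(1,\,g,\,g^2,\,g^3,\,x,\,gx,\,g^2x,\,g^3x)$: $\varepsilon_{\mathcal{A}_{4,q}'''}=(1,1,1,1,0,0,0,0)$; $\lambda_{\{1\}}=(1,0,0,0,\alpha,0,\alpha,0)$; and $\lambda_{\{1,g^2\}}=(1,0,1,0,0,0,0,0)$. (5) $\mathcal{A}_{2,2}$, values on $(1,\,g,\,h,\,gh,\,x,\,gx,\,hx,\,ghx)$: $\varepsilon_{\mathcal{A}_{2,2}}=(1,1,1,1,0,0,0,0)$; $\lambda_{\{1\}}=(1,0,0,0,\alpha,\alpha,0,0)$; $\lambda_{\{1,gh\}}=(1,0,0,1,\alpha,\alpha,\alpha,\alpha)$; $\lambda_{\{1,h\}}=(1,0,1,0,0,0,0,0)$; and $\lambda_{\{1,g\}}=(1,1,0,0,0,0,0,0)$.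
   Context: Sweedler notation $\Delta(h)=h_1\otimes h_2$ is used. A partial action of a Hopf algebra $H$ on its base field $\Bbbk$ is a linear map $\lambda: H\to\Bbbk$ such that $\lambda(1_H)=1_\Bbbk$ and $\lambda(h)\lambda(k)=\lambda(h_1)\lambda(h_2k)$ for all $h,k\in H$. The subscript $N$ in $\lambda_N$ records $N=\{g\in G(H)\mid\lambda(g)=1\}$. $G(H)$ is the group of group-like elements, and $x\in P_{1,s}(H)$ means $\Delta(x)=x\otimes 1+s\otimes x$ for the group-like element $s$. The Hopf algebras are given by generators and relations as follows; in each one the listed $g$ (and $h$) are group-like. $\mathcal{A}_2=\langle g,x,y\mid g^2=1,\ x^2=y^2=0,\ xg=-gx,\ yg=-gy,\ yx=-xy\rangle$, with $x,y\in P_{1,g}(\mathcal{A}_2)$. $\mathcal{A}_4'=\langle g,x\mid g^4=1,\ x^2=0,\ xg=-gx\rangle$, with $x\in P_{1,g}(\mathcal{A}_4')$. $\mathcal{A}_4''=\langle g,x\mid g^4=1,\ x^2=g^2-1,\ xg=-gx\rangle$, with $x\in P_{1,g}(\mathcal{A}_4'')$. $\mathcal{A}_{4,q}'''=\langle g,x\mid g^4=1,\ x^2=0,\ gx=qxg\rangle$, where $q$ is a primitive root of unity of order $4$, with $x\in P_{1,g^2}(\mathcal{A}_{4,q}''')$. $\mathcal{A}_{2,2}=\langle g,h,x\mid g^2=h^2=1,\ x^2=0,\ xg=-gx,\ xh=-hx,\ hg=gh\rangle$, with $x\in P_{1,g}(\mathcal{A}_{2,2})$. It is a known classification that these are, up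 to isomorphism, all the pointed non-semisimple Hopf algebras of dimension $8$ over $\Bbbk$. *)

theory Defs
  imports
    "HOL-Library.Poly_Mapping"
    "HOL-Computational_Algebra.Polynomial"
begin

section \<open>Free vector spaces\<close>

definition pm_scale :: "'k::field \<Rightarrow> ('b \<Rightarrow>\<^sub>0 'k) \<Rightarrow> ('b \<Rightarrow>\<^sub>0 'k)" where
  "pm_scale c t = Poly_Mapping.map ((*) c) t"

text \<open>The linear extension of \<open>f\<close> to the free vector space on its domain; \<open>sc\<close> is the scalar
  multiplication of the target space.\<close>

definition lin_ext ::
    "('k::field \<Rightarrow> 'v \<Rightarrow> 'v::ab_group_add) \<Rightarrow> ('b \<Rightarrow> 'v) \<Rightarrow> ('b \<Rightarrow>\<^sub>0 'k) \<Rightarrow> 'v" where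
  "lin_ext sc f t = (\<Sum>b\<in>Poly_Mapping.keys t. sc (Poly_Mapping.lookup t b) (f b))"


section \<open>Tensor powers\<close>

text \<open>The tensor product \<open>V \<otimes> V\<close> is the free vector space on \<open>V \<times> V\<close> modulo the span of the
  bilinearity relations. Its elements are handled through representatives: two formal sums are
  identified by \<open>teq2\<close>. Likewise \<open>teq3\<close> for \<open>V \<otimes> V \<otimes> V\<close>.\<close>

definition pure :: "'a \<Rightarrow> 'b \<Rightarrow> ('a \<times> 'b \<Rightarrow>\<^sub>0 'k::field)" (infix \<open>\<otimes>\<close> 75) where
  "a \<otimes> b = Poly_Mapping.single (a, b) 1"

definition pure3 :: "'a \<Rightarrow> 'b \<Rightarrow> 'c \<Rightarrow> ('a \<times> 'b \<times> 'c \<Rightarrow>\<^sub>0 'k::field)" where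
  "pure3 a b c = Poly_Mapping.single (a, b, c) 1"

definition null2 ::
    "('k::field \<Rightarrow> 'a \<Rightarrow> 'a::ab_group_add) \<Rightarrow> ('a \<times> 'a \<Rightarrow>\<^sub>0 'k) set" where
  "null2 scale = module.span pm_scale
     ({(a + a') \<otimes> b - a \<otimes> b - a' \<otimes> b | a a' b. True} \<union>
      {a \<otimes> (b + b') - a \<otimes> b - a \<otimes> b' | a b b'. True} \<union>
      {(scale r a) \<otimes> b - pm_scale r (a \<otimes> b) | r a b. True} \<union>
      {a \<otimes> (scale r b) - pm_scale r (a \<otimes> b) | r a b. True})"

definition null3 ::
    "('k::field \<Rightarrow> 'a \<Rightarrow> 'a::ab_group_add) \<Rightarrow> ('a \<times> 'a \<times> 'a \<Rightarrow>\<^sub>0 'k) set" where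
  "null3 scale = module.span pm_scale
     ({pure3 (a + a') b c - pure3 a b c - pure3 a' b c | a a' b c. True} \<union>
      {pure3 a (b + b') c - pure3 a b c - pure3 a b' c | a b b' c. True} \<union>
      {pure3 a b (c + c') - pure3 a b c - pure3 a b c' | a b c c'. True} \<union>
      {pure3 (scale r a) b c - pm_scale r (pure3 a b c) | r a b c. True} \<union>
      {pure3 a (scale r b) c - pm_scale r (pure3 a b c) | r a b c. True} \<union>
      {pure3 a b (scale r c) - pm_scale r (pure3 a b c) | r a b c. True})"

definition teq2 :: "('k::field \<Rightarrow> 'a \<Rightarrow> 'a::ab_group_add) \<Rightarrow>
    ('a \<times> 'a \<Rightarrow>\<^sub>0 'k) \<Rightarrow> ('a \<times> 'a \<Rightarrow>\<^sub>0 'k) \<Rightarrow> bool" where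
  "teq2 scale t u \<longleftrightarrow> t - u \<in> null2 scale"

definition teq3 :: "('k::field \<Rightarrow> 'a \<Rightarrow> 'a::ab_group_add) \<Rightarrow>
    ('a \<times> 'a \<times> 'a \<Rightarrow>\<^sub>0 'k) \<Rightarrow> ('a \<times> 'a \<times> 'a \<Rightarrow>\<^sub>0 'k) \<Rightarrow> bool" where
  "teq3 scale t u \<longleftrightarrow> t - u \<in> null3 scale"

text \<open>The product of the tensor algebra square, \<open>(a \<otimes> b)(c \<otimes> d) = ac \<otimes> bd\<close>. It must not be confused
  with the multiplication that \<open>Poly_Mapping\<close> derives from addition of keys.\<close>

definition tmult :: "('a::ring_1 \<times> 'a \<Rightarrow>\<^sub>0 'k::field) \<Rightarrow> ('a \<times> 'a \<Rightarrow>\<^sub>0 'k) \<Rightarrow> ('a \<times> 'a \<Rightarrow>\<^sub>0 'k)" where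
  "tmult t u = lin_ext pm_scale (\<lambda>(a, b). lin_ext pm_scale (\<lambda>(c, d). (a * c) \<otimes> (b * d)) u) t"


section \<open>Hopf algebras\<close>

text \<open>The comultiplication \<open>\<Delta>\<close> picks a representing formal sum \<open>h\<^sub>1 \<otimes> h\<^sub>2\<close> for each \<open>h\<close>
  (Sweedler notation); all axioms are imposed modulo the tensor relations only.\<close>

locale hopf_algebra = vector_space scale
  for scale :: "'k::field \<Rightarrow> 'a::ring_1 \<Rightarrow> 'a" +
  fixes \<Delta> :: "'a \<Rightarrow> ('a \<times> 'a \<Rightarrow>\<^sub>0 'k)"
    and \<epsilon> :: "'a \<Rightarrow> 'k"
    and S :: "'a \<Rightarrow> 'a"
  assumes scale_mult_left: "scale r a * b = scale r (a * b)"
    and scale_mult_right: "a * scale r b = scale r (a * b)"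
    and comult_add: "teq2 scale (\<Delta> (a + b)) (\<Delta> a + \<Delta> b)"
    and comult_scale: "teq2 scale (\<Delta> (scale r a)) (pm_scale r (\<Delta> a))"
    and coassoc: "teq3 scale
      (lin_ext pm_scale (\<lambda>(a, b). lin_ext pm_scale (\<lambda>(c, d). pure3 c d b) (\<Delta> a)) (\<Delta> h))
      (lin_ext pm_scale (\<lambda>(a, b). lin_ext pm_scale (\<lambda>(c, d). pure3 a c d) (\<Delta> b)) (\<Delta> h))"
    and counit_linear: "Vector_Spaces.linear scale (*) \<epsilon>"
    and counit_left: "lin_ext scale (\<lambda>(a, b). scale (\<epsilon> a) b) (\<Delta> h) = h"
    and counit_right: "lin_ext scale (\<lambda>(a, b). scale (\<epsilon> b) a) (\<Delta> h) = h"
    and comult_mult: "teq2 scale (\<Delta> (a * b)) (tmult (\<Delta> a) (\<Delta> b))"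
    and comult_one: "teq2 scale (\<Delta> 1) (1 \<otimes> 1)"
    and counit_mult: "\<epsilon> (a * b) = \<epsilon> a * \<epsilon> b"
    and counit_one: "\<epsilon> 1 = 1"
    and antipode_linear: "Vector_Spaces.linear scale scale S"
    and antipode_left: "lin_ext scale (\<lambda>(a, b). S a * b) (\<Delta> h) = scale (\<epsilon> h) 1"
    and antipode_right: "lin_ext scale (\<lambda>(a, b). a * S b) (\<Delta> h) = scale (\<epsilon> h) 1"

definition group_like :: "('k::field \<Rightarrow> 'a::ring_1 \<Rightarrow> 'a) \<Rightarrow> ('a \<Rightarrow> ('a \<times> 'a \<Rightarrow>\<^sub>0 'k)) \<Rightarrow> 'a \<Rightarrow> bool" where
  "group_like scale \<Delta> u \<longleftrightarrow> u \<noteq> 0 \<and> teq2 scale (\<Delta> u) (u \<otimes> u)"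

text \<open>Membership of \<open>x\<close> in \<open>P\<^sub>1\<^sub>,\<^sub>s\<close>.\<close>

definition skew_primitive ::
    "('k::field \<Rightarrow> 'a::ring_1 \<Rightarrow> 'a) \<Rightarrow> ('a \<Rightarrow> ('a \<times> 'a \<Rightarrow>\<^sub>0 'k)) \<Rightarrow> 'a \<Rightarrow> 'a \<Rightarrow> bool" where
  "skew_primitive scale \<Delta> s x \<longleftrightarrow> teq2 scale (\<Delta> x) (x \<otimes> 1 + s \<otimes> x)"

text \<open>The last clause is \<open>\<lambda>(h) \<lambda>(k) = \<lambda>(h\<^sub>1) \<lambda>(h\<^sub>2 k)\<close>.\<close>

definition partial_action ::
    "('k::field \<Rightarrow> 'a::ring_1 \<Rightarrow> 'a) \<Rightarrow> ('a \<Rightarrow> ('a \<times> 'a \<Rightarrow>\<^sub>0 'k)) \<Rightarrow> ('a \<Rightarrow> 'k) \<Rightarrow> bool" where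
  "partial_action scale \<Delta> lam \<longleftrightarrow>
     Vector_Spaces.linear scale (*) lam \<and> lam 1 = 1 \<and>
     (\<forall>h k. lam h * lam k = lin_ext (*) (\<lambda>(a, b). lam a * lam (b * k)) (\<Delta> h))"

text \<open>The set \<open>N = {u \<in> G(H). \<lambda>(u) = 1}\<close> recorded by the subscript of \<open>\<lambda>\<^sub>N\<close>.\<close>

definition unit_locus ::
    "('k::field \<Rightarrow> 'a::ring_1 \<Rightarrow> 'a) \<Rightarrow> ('a \<Rightarrow> ('a \<times> 'a \<Rightarrow>\<^sub>0 'k)) \<Rightarrow> ('a \<Rightarrow> 'k) \<Rightarrow> 'a set" where
  "unit_locus scale \<Delta> lam = {u. group_like scale \<Delta> u \<and> lam u = 1}"

definition is_basis :: "('k::field \<Rightarrow> 'a::ab_group_add \<Rightarrow> 'a) \<Rightarrow> 'a list \<Rightarrow> bool" where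
  "is_basis scale B \<longleftrightarrow>
     distinct B \<and> \<not> module.dependent scale (set B) \<and> module.span scale (set B) = UNIV"

definition has_values ::
    "('k::field \<Rightarrow> 'a::ab_group_add \<Rightarrow> 'a) \<Rightarrow> 'a list \<Rightarrow> ('a \<Rightarrow> 'k) \<Rightarrow> 'k list \<Rightarrow> bool" where
  "has_values scale B lam vs \<longleftrightarrow> Vector_Spaces.linear scale (*) lam \<and> map lam B = vs"


section \<open>Presentations by generators and relations\<close>

text \<open>The free algebra on \<open>'g\<close> is the monoid algebra \<open>'g word \<Rightarrow>\<^sub>0 'k\<close> of the free monoid: since
  \<open>Poly_Mapping\<close> multiplies by adding keys, concatenation of words is written additively.\<close>

datatype 'g word = Word (letters: "'g list")

instantiation word :: (type) monoid_add
begin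

definition zero_word :: "'a word" where
  "0 = Word []"

definition plus_word :: "'a word \<Rightarrow> 'a word \<Rightarrow> 'a word" where
  "u + v = Word (letters u @ letters v)"

instance
  by standard (simp_all add: zero_word_def plus_word_def)

end

definition gen :: "'g \<Rightarrow> ('g word \<Rightarrow>\<^sub>0 'k::field)" where
  "gen c = Poly_Mapping.single (Word [c]) 1"

definition const :: "'k::field \<Rightarrow> ('g word \<Rightarrow>\<^sub>0 'k)" where
  "const r = Poly_Mapping.single 0 r"

definition eval_free ::
    "('k::field \<Rightarrow> 'a::ring_1 \<Rightarrow> 'a) \<Rightarrow> ('g \<Rightarrow> 'a) \<Rightarrow> ('g word \<Rightarrow>\<^sub>0 'k) \<Rightarrow> 'a" where
  "eval_free scale \<phi> = lin_ext scale (\<lambda>w. prod_list (map \<phi> (letters w)))"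

definition two_sided_ideal :: "'r::ring_1 set \<Rightarrow> bool" where
  "two_sided_ideal I \<longleftrightarrow> 0 \<in> I \<and> (\<forall>a\<in>I. \<forall>b\<in>I. a + b \<in> I) \<and> (\<forall>a\<in>I. \<forall>r. r * a \<in> I \<and> a * r \<in> I)"

text \<open>A pair \<open>(l, r)\<close> stands for the relation \<open>l = r\<close>.\<close>

definition relation_ideal :: "('r::ring_1 \<times> 'r) set \<Rightarrow> 'r set" where
  "relation_ideal E = \<Inter> {I. two_sided_ideal I \<and> (\<forall>(l, r)\<in>E. l - r \<in> I)}"

text \<open>The algebra is \<open>\<langle>'g | E\<rangle>\<close> with generators \<open>\<phi>\<close>: evaluation at \<open>\<phi>\<close> induces an isomorphism
  from the quotient of the free algebra by the ideal of the relations.\<close>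

definition presents ::
    "('k::field \<Rightarrow> 'a::ring_1 \<Rightarrow> 'a) \<Rightarrow> ('g \<Rightarrow> 'a) \<Rightarrow>
     (('g word \<Rightarrow>\<^sub>0 'k) \<times> ('g word \<Rightarrow>\<^sub>0 'k)) set \<Rightarrow> bool" where
  "presents scale \<phi> E \<longleftrightarrow>
     surj (eval_free scale \<phi>) \<and> {p. eval_free scale \<phi> p = 0} = relation_ideal E"


section \<open>The pointed non-semisimple Hopf algebras of dimension 8\<close>

datatype gxy = Gxy_g | Gxy_x | Gxy_y
datatype gx = Gx_g | Gx_x
datatype ghx = Ghx_g | Ghx_h | Ghx_x

definition rels_A2 :: "((gxy word \<Rightarrow>\<^sub>0 'k::field) \<times> (gxy word \<Rightarrow>\<^sub>0 'k)) set" where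
  "rels_A2 = (let g = gen Gxy_g; x = gen Gxy_x; y = gen Gxy_y in
     {(g ^ 2, 1), (x ^ 2, 0), (y ^ 2, 0), (x * g, - (g * x)), (y * g, - (g * y)), (y * x, - (x * y))})"

definition rels_A4' :: "((gx word \<Rightarrow>\<^sub>0 'k::field) \<times> (gx word \<Rightarrow>\<^sub>0 'k)) set" where
  "rels_A4' = (let g = gen Gx_g; x = gen Gx_x in
     {(g ^ 4, 1), (x ^ 2, 0), (x * g, - (g * x))})"

definition rels_A4'' :: "((gx word \<Rightarrow>\<^sub>0 'k::field) \<times> (gx word \<Rightarrow>\<^sub>0 'k)) set" where
  "rels_A4'' = (let g = gen Gx_g; x = gen Gx_x in
     {(g ^ 4, 1), (x ^ 2, g ^ 2 - 1), (x * g, - (g * x))})"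

definition rels_A4''' :: "'k::field \<Rightarrow> ((gx word \<Rightarrow>\<^sub>0 'k) \<times> (gx word \<Rightarrow>\<^sub>0 'k)) set" where
  "rels_A4''' q = (let g = gen Gx_g; x = gen Gx_x in
     {(g ^ 4, 1), (x ^ 2, 0), (g * x, const q * x * g)})"

definition rels_A22 :: "((ghx word \<Rightarrow>\<^sub>0 'k::field) \<times> (ghx word \<Rightarrow>\<^sub>0 'k)) set" where
  "rels_A22 = (let g = gen Ghx_g; h = gen Ghx_h; x = gen Ghx_x in
     {(g ^ 2, 1), (h ^ 2, 1), (x ^ 2, 0), (x * g, - (g * x)), (x * h, - (h * x)), (h * g, g * h)})"

definition primitive_root_of_unity :: "nat \<Rightarrow> 'k::field \<Rightarrow> bool" where
  "primitive_root_of_unity n q \<longleftrightarrow> n > 0 \<and> q ^ n = 1 \<and> (\<forall>m. 0 < m \<and> m < n \<longrightarrow> q ^ m \<noteq> 1)"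

text \<open>For a Hopf algebra, the following predicates state that it is the respective algebra with the
  given elements as its generators. The comultiplication is determined by its values on
  generators, being an algebra map.\<close>

definition is_A2 ::
    "('k::field \<Rightarrow> 'a::ring_1 \<Rightarrow> 'a) \<Rightarrow> ('a \<Rightarrow> ('a \<times> 'a \<Rightarrow>\<^sub>0 'k)) \<Rightarrow> 'a \<Rightarrow> 'a \<Rightarrow> 'a \<Rightarrow> bool" where
  "is_A2 scale \<Delta> g x y \<longleftrightarrow> presents scale (case_gxy g x y) rels_A2 \<and>
     group_like scale \<Delta> g \<and> skew_primitive scale \<Delta> g x \<and> skew_primitive scale \<Delta> g y"

definition is_A4' ::
    "('k::field \<Rightarrow> 'a::ring_1 \<Rightarrow> 'a) \<Rightarrow> ('a \<Rightarrow> ('a \<times> 'a \<Rightarrow>\<^sub>0 'k)) \<Rightarrow> 'a \<Rightarrow> 'a \<Rightarrow> bool" where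
  "is_A4' scale \<Delta> g x \<longleftrightarrow> presents scale (case_gx g x) rels_A4' \<and>
     group_like scale \<Delta> g \<and> skew_primitive scale \<Delta> g x"

definition is_A4'' ::
    "('k::field \<Rightarrow> 'a::ring_1 \<Rightarrow> 'a) \<Rightarrow> ('a \<Rightarrow> ('a \<times> 'a \<Rightarrow>\<^sub>0 'k)) \<Rightarrow> 'a \<Rightarrow> 'a \<Rightarrow> bool" where
  "is_A4'' scale \<Delta> g x \<longleftrightarrow> presents scale (case_gx g x) rels_A4'' \<and>
     group_like scale \<Delta> g \<and> skew_primitive scale \<Delta> g x"

definition is_A4''' ::
    "('k::field \<Rightarrow> 'a::ring_1 \<Rightarrow> 'a) \<Rightarrow> ('a \<Rightarrow> ('a \<times> 'a \<Rightarrow>\<^sub>0 'k)) \<Rightarrow> 'k \<Rightarrow> 'a \<Rightarrow> 'a \<Rightarrow> bool" where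
  "is_A4''' scale \<Delta> q g x \<longleftrightarrow> presents scale (case_gx g x) (rels_A4''' q) \<and>
     group_like scale \<Delta> g \<and> skew_primitive scale \<Delta> (g ^ 2) x"

definition is_A22 ::
    "('k::field \<Rightarrow> 'a::ring_1 \<Rightarrow> 'a) \<Rightarrow> ('a \<Rightarrow> ('a \<times> 'a \<Rightarrow>\<^sub>0 'k)) \<Rightarrow> 'a \<Rightarrow> 'a \<Rightarrow> 'a \<Rightarrow> bool" where
  "is_A22 scale \<Delta> g h x \<longleftrightarrow> presents scale (case_ghx g h x) rels_A22 \<and>
     group_like scale \<Delta> g \<and> group_like scale \<Delta> h \<and> skew_primitive scale \<Delta> g x"

end

theory Submission
  imports Defs "HOL-Library.Product_Plus"
begin

text \<open>
  For a group-like \<open>u\<close> and an element \<open>w\<close> with \<open>\<Delta> w = w \<otimes> u + v \<otimes> w\<close> the defining equation of a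
  partial action reads
  \<open>\<lambda>(u) \<lambda>(k) = \<lambda>(u) \<lambda>(u k)\<close> and \<open>\<lambda>(w) \<lambda>(k) = \<lambda>(w) \<lambda>(u k) + \<lambda>(v) \<lambda>(w k)\<close>.
  The first equation makes \<open>\<lambda>(u)\<close> either \<open>0\<close> or \<open>1\<close>, and in the latter case \<open>\<lambda>\<close> is invariant under
  left multiplication by \<open>u\<close>; so \<open>\<lambda>\<close> on the group-likes is the indicator of a subgroup. In all five
  algebras the basis consists of group-likes and such skew-primitive elements, apart from \<open>x y\<close> and
  \<open>g x y\<close> in \<open>\<A>\<^sub>2\<close>. Hence a map is a partial action exactly if finitely many scalar equations
  hold on the basis (\<open>partial_action_basisI\<close>, \<open>rank_one_hopf.partial_action_iff\<close>), and a case
  distinction on the subgroup solves them.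

  Three further points carry the proof.

  \<^item> The comultiplication is given only through representatives modulo the tensor relations, so it is
  used through the values of bilinear forms on it. These depend on the class alone
  (\<open>teq2_lin_ext_form\<close>), and multiplicativity of \<open>\<Delta>\<close> turns the values on generators into values on
  products (\<open>coev_mult\<close>, \<open>is_skew_mult_left\<close>).

  \<^item> That the eight monomials form a basis is a statement about the presentation: they span since the
  relations rewrite every product into normal form (\<open>presents_span\<close>), and they are independent since
  the relations hold for explicit operators on \<open>k\<^sup>8\<close>, which are the left regular
  representation written out. The presented algebra therefore maps to \<open>k\<^sup>8\<close>
  (\<open>presents_module_map\<close>), sending the monomials to the unit vectors.

  \<^item> The subscripts of the maps require all group-likes of the algebra. In \<open>\<Delta> u = u \<otimes> u\<close> the
  coefficient of \<open>b \<otimes> b\<close> is the square of the coefficient of \<open>b\<close> in \<open>u\<close> on the right hand side, while on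
  the left hand side it only sees group-like basis elements. This leaves exactly the group-likes in the
  basis (\<open>group_like_iff_in_basis\<close>).

  The algebras \<open>\<A>\<^sub>4'\<close>, \<open>\<A>\<^sub>4''\<close> and \<open>\<A>\<^sub>4'''\<close> share the relations \<open>g\<^sup>4 = 1\<close>, \<open>x g = c g x\<close>,
  \<open>x\<^sup>2 = t (g\<^sup>2 - 1)\<close>, and are treated together with the scalars \<open>c\<close> and \<open>t\<close> as parameters.
\<close>

section \<open>Preliminaries\<close>

lemma two_neq_one: "(2 :: 'k::field) \<noteq> 1"
proof
  assume "(2 :: 'k) = 1"
  then have "1 + 1 = (1 + 0 :: 'k)" by simp
  then show False by (simp only: add_left_cancel one_neq_zero)
qed

lemma poly_mapping_add_induct [case_names single add]:
  assumes "\<And>a b. P (Poly_Mapping.single a b)" "\<And>f g. P f \<Longrightarrow> P g \<Longrightarrow> P (f + g)"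
  shows "P (f :: 'a \<Rightarrow>\<^sub>0 'b::comm_monoid_add)"
proof (induction f rule: update_induct)
  case const
  show ?case using assms(1)[of _ 0] by simp
next
  case (update f a b)
  have "Poly_Mapping.update a b f = f + Poly_Mapping.single a b"
    using update(1) by (intro poly_mapping_eqI)
      (auto simp: lookup_update lookup_add lookup_single in_keys_iff when_def)
  then show ?case using update assms by simp
qed

section \<open>Linear extension and the tensor relations\<close>

lemma lookup_pm_scale: "Poly_Mapping.lookup (pm_scale c t) b = c * Poly_Mapping.lookup t b"
  by (simp add: pm_scale_def map.rep_eq when_def)

context vector_space
begin

lemma lin_ext_superset:
  assumes "finite A" "Poly_Mapping.keys t \<subseteq> A"
  shows "lin_ext scale f t = (\<Sum>b\<in>A. scale (Poly_Mapping.lookup t b) (f b))"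
  unfolding lin_ext_def
  by (rule sum.mono_neutral_left) (use assms in \<open>auto simp: in_keys_iff\<close>)

lemma lin_ext_zero [simp]: "lin_ext scale f 0 = 0"
  by (simp add: lin_ext_def)

lemma lin_ext_single [simp]: "lin_ext scale f (Poly_Mapping.single b c) = scale c (f b)"
  by (subst lin_ext_superset[where A="{b}"]) (auto simp: lookup_single)

lemma lin_ext_add: "lin_ext scale f (t + u) = lin_ext scale f t + lin_ext scale f u"
proof -
  let ?A = "Poly_Mapping.keys t \<union> Poly_Mapping.keys u"
  have "lin_ext scale f (t + u) = (\<Sum>b\<in>?A. scale (Poly_Mapping.lookup (t + u) b) (f b))"
    by (rule lin_ext_superset) (auto dest: keys_add[THEN subsetD])
  also have "\<dots> = lin_ext scale f t + lin_ext scale f u"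
    by (simp add: lin_ext_superset[where A="?A"] lookup_add scale_left_distrib sum.distrib)
  finally show ?thesis .
qed

lemma lin_ext_pm_scale: "lin_ext scale f (pm_scale c t) = scale c (lin_ext scale f t)"
proof -
  have "Poly_Mapping.keys (pm_scale c t) \<subseteq> Poly_Mapping.keys t"
    by (auto simp: in_keys_iff lookup_pm_scale)
  then have "lin_ext scale f (pm_scale c t) =
      (\<Sum>b\<in>Poly_Mapping.keys t. scale (Poly_Mapping.lookup (pm_scale c t) b) (f b))"
    by (intro lin_ext_superset) auto
  also have "\<dots> = scale c (lin_ext scale f t)"
    by (simp add: lin_ext_def scale_sum_right lookup_pm_scale)
  finally show ?thesis .
qed

lemma lin_ext_fun_add: "lin_ext scale (\<lambda>b. f b + f' b) t = lin_ext scale f t + lin_ext scale f' t"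
  by (simp add: lin_ext_def scale_right_distrib sum.distrib)

lemma lin_ext_fun_scale: "lin_ext scale (\<lambda>b. scale r (f b)) t = scale r (lin_ext scale f t)"
  by (simp add: lin_ext_def scale_sum_right mult.commute)

lemma lin_ext_uminus: "lin_ext scale f (- t) = - lin_ext scale f t"
  using lin_ext_add[of f t "- t"] by (simp add: eq_neg_iff_add_eq_0 add.commute)

lemma lin_ext_diff: "lin_ext scale f (t - u) = lin_ext scale f t - lin_ext scale f u"
  using lin_ext_add[of f t "- u"] by (simp add: lin_ext_uminus)

lemma lin_ext_in_subspace:
  assumes "subspace N" "\<And>b. f b \<in> N"
  shows "lin_ext scale f t \<in> N"
  unfolding lin_ext_def using assms by (intro subspace_sum subspace_scale) auto

end

lemma vector_space_pm_scale: "vector_space pm_scale"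
  by standard (auto intro!: poly_mapping_eqI simp: lookup_pm_scale lookup_add algebra_simps)

interpretation pm: vector_space pm_scale
  by (rule vector_space_pm_scale)

lemma vector_space_mult: "vector_space ((*) :: 'k::field \<Rightarrow> 'k \<Rightarrow> 'k)"
  by standard (auto simp: algebra_simps)

interpretation field: vector_space "(*) :: 'k::field \<Rightarrow> 'k \<Rightarrow> 'k"
  by (rule vector_space_mult)

text \<open>For a field over itself this rule is associativity from right to left, and the simplifier would
  loop with \<open>mult.assoc\<close>.\<close>

declare field.scale_scale [simp del]

context vector_space
begin

text \<open>The universal property of the tensor product, relative to a subspace: a map that is bilinear
  modulo \<open>N\<close> extends linearly to a map that is well defined modulo \<open>N\<close>. With \<open>N = {0}\<close> this evaluates
  bilinear maps on tensors; with \<open>N\<close> the tensor relations themselves it gives the product of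
  tensors.\<close>

lemma lin_ext_null2:
  assumes N: "subspace N"
    and "\<And>a a' b. f (a + a', b) - f (a, b) - f (a', b) \<in> N"
    and "\<And>a b b'. f (a, b + b') - f (a, b) - f (a, b') \<in> N"
    and "\<And>r a b. f (sc r a, b) - scale r (f (a, b)) \<in> N"
    and "\<And>r a b. f (a, sc r b) - scale r (f (a, b)) \<in> N"
    and t: "t \<in> null2 sc"
  shows "lin_ext scale f t \<in> N"
proof -
  have "t \<in> {u. lin_ext scale f u \<in> N}"
    using t unfolding null2_def
  proof (rule pm.span_induct, goal_cases)
    case 1
    show ?case
      using N by (auto simp: pm.subspace_def lin_ext_add lin_ext_pm_scale subspace_def)
  next
    case (2 x)
    then show ?case
      using assms(2-5) by (auto simp: lin_ext_diff lin_ext_pm_scale pure_def)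
  qed
  then show ?thesis by simp
qed

end

section \<open>Modules over the free algebra and presentations\<close>

text \<open>The action of the free algebra on the module in which the letter \<open>c\<close> acts by \<open>\<rho> c\<close>.\<close>

definition act ::
    "('k::field \<Rightarrow> 'v \<Rightarrow> 'v::ab_group_add) \<Rightarrow> ('g \<Rightarrow> 'v \<Rightarrow> 'v) \<Rightarrow> ('g word \<Rightarrow>\<^sub>0 'k) \<Rightarrow> 'v \<Rightarrow> 'v" where
  "act sc \<rho> p v = lin_ext sc (\<lambda>w. foldr \<rho> (letters w) v) p"

locale free_algebra_module = vector_space scale
  for scale :: "'k::field \<Rightarrow> 'v::ab_group_add \<Rightarrow> 'v" +
  fixes \<rho> :: "'g \<Rightarrow> 'v \<Rightarrow> 'v"
  assumes letter_add: "\<rho> c (v + w) = \<rho> c v + \<rho> c w"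
    and letter_scale: "\<rho> c (scale r v) = scale r (\<rho> c v)"
begin

lemma foldr_letter_add: "foldr \<rho> cs (v + w) = foldr \<rho> cs v + foldr \<rho> cs w"
  by (induction cs) (auto simp: letter_add)

lemma foldr_letter_scale: "foldr \<rho> cs (scale r v) = scale r (foldr \<rho> cs v)"
  by (induction cs) (auto simp: letter_scale)

lemma act_add: "act scale \<rho> (p + q) v = act scale \<rho> p v + act scale \<rho> q v"
  by (simp add: act_def lin_ext_add)

lemma act_diff: "act scale \<rho> (p - q) v = act scale \<rho> p v - act scale \<rho> q v"
  by (simp add: act_def lin_ext_diff)

lemma act_uminus: "act scale \<rho> (- p) v = - act scale \<rho> p v"
  by (simp add: act_def lin_ext_uminus)

lemma act_0: "act scale \<rho> 0 v = 0"
  by (simp add: act_def)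

lemma act_pm_scale: "act scale \<rho> (pm_scale r p) v = scale r (act scale \<rho> p v)"
  by (simp add: act_def lin_ext_pm_scale)

lemma act_const: "act scale \<rho> (const r) v = scale r v"
  by (simp add: act_def const_def zero_word_def)

lemma act_1: "act scale \<rho> 1 v = v"
  using act_const[of 1] by (simp add: const_def)

lemma act_gen: "act scale \<rho> (gen c) v = \<rho> c v"
  by (simp add: act_def gen_def)

lemma act_vector_add: "act scale \<rho> p (v + w) = act scale \<rho> p v + act scale \<rho> p w"
  by (simp add: act_def foldr_letter_add lin_ext_fun_add)

lemma act_vector_scale: "act scale \<rho> p (scale r v) = scale r (act scale \<rho> p v)"
  by (simp add: act_def foldr_letter_scale lin_ext_fun_scale)

lemma act_mult: "act scale \<rho> (p * q) v = act scale \<rho> p (act scale \<rho> q v)"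
proof (induction p rule: poly_mapping_add_induct)
  case (single w c)
  show ?case
  proof (induction q rule: poly_mapping_add_induct)
    case (single w' c')
    show ?case
      by (simp add: mult_single act_def plus_word_def foldr_letter_scale)
  next
    case (add f h)
    then show ?case
      by (simp only: distrib_left act_add act_vector_add)
  qed
next
  case (add f h)
  then show ?case
    by (simp only: distrib_right act_add)
qed

text \<open>The annihilator of a module is a two-sided ideal.\<close>

lemma act_relation_ideal:
  assumes "\<And>l r v. (l, r) \<in> E \<Longrightarrow> act scale \<rho> l v = act scale \<rho> r v"
    and "p \<in> relation_ideal E"
  shows "act scale \<rho> p v = 0"
proof -
  let ?I = "{p. \<forall>v. act scale \<rho> p v = 0}"
  have "act scale \<rho> p 0 = 0" for p
    using act_vector_scale[of p 0 0] by simp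
  then have "two_sided_ideal ?I"
    by (auto simp: two_sided_ideal_def act_0 act_add act_mult)
  moreover have "\<forall>(l, r)\<in>E. l - r \<in> ?I"
    using assms(1) by (auto simp: act_diff)
  ultimately have "p \<in> ?I"
    using assms(2) unfolding relation_ideal_def by blast
  then show ?thesis by simp
qed

end

locale k_algebra = vector_space scale
  for scale :: "'k::field \<Rightarrow> 'a::ring_1 \<Rightarrow> 'a" +
  assumes scale_times: "scale r a * b = scale r (a * b)"
    and times_scale: "a * scale r b = scale r (a * b)"
begin

sublocale left_mult: free_algebra_module scale "\<lambda>c a. \<phi> c * a" for \<phi> :: "'g \<Rightarrow> 'a"
  by standard (auto simp: algebra_simps times_scale)

lemma prod_list_eq_foldr: "prod_list (map \<phi> cs) * a = foldr (\<lambda>c a. \<phi> c * a) cs a"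
  by (induction cs) (auto simp: mult.assoc)

text \<open>Evaluation at \<open>\<phi>\<close> is the action on the algebra itself by left multiplication; the algebra map
  properties of \<open>eval_free\<close> below are instances of the module laws.\<close>

lemma act_left_mult: "act scale (\<lambda>c a. \<phi> c * a) p a = eval_free scale \<phi> p * a"
  by (simp add: eval_free_def act_def lin_ext_def sum_distrib_right scale_times
      prod_list_eq_foldr[symmetric])

lemma eval_free_gen: "eval_free scale \<phi> (gen c) = \<phi> c"
  using act_left_mult[of \<phi> "gen c" 1] left_mult.act_gen[of \<phi> c 1] by simp

lemma eval_free_const: "eval_free scale \<phi> (const r) = scale r 1"
  using act_left_mult[of \<phi> "const r" 1] left_mult.act_const[of \<phi> r 1] by simp

lemma eval_free_0: "eval_free scale \<phi> 0 = 0"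
  using act_left_mult[of \<phi> 0 1] left_mult.act_0[of \<phi> 1] by simp

lemma eval_free_1: "eval_free scale \<phi> 1 = 1"
  using act_left_mult[of \<phi> 1 1] left_mult.act_1[of \<phi> 1] by simp

lemma eval_free_add: "eval_free scale \<phi> (p + q) = eval_free scale \<phi> p + eval_free scale \<phi> q"
  using act_left_mult[of \<phi> _ 1] left_mult.act_add[of \<phi> p q 1] by simp

lemma eval_free_diff: "eval_free scale \<phi> (p - q) = eval_free scale \<phi> p - eval_free scale \<phi> q"
  using act_left_mult[of \<phi> _ 1] left_mult.act_diff[of \<phi> p q 1] by simp

lemma eval_free_uminus: "eval_free scale \<phi> (- p) = - eval_free scale \<phi> p"
  using act_left_mult[of \<phi> _ 1] left_mult.act_uminus[of \<phi> p 1] by simp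

lemma eval_free_pm_scale: "eval_free scale \<phi> (pm_scale r p) = scale r (eval_free scale \<phi> p)"
  using act_left_mult[of \<phi> _ 1] left_mult.act_pm_scale[of \<phi> r p 1] by simp

lemma eval_free_mult: "eval_free scale \<phi> (p * q) = eval_free scale \<phi> p * eval_free scale \<phi> q"
  using act_left_mult[of \<phi>] left_mult.act_mult[of \<phi> p q 1] by simp

lemma eval_free_power: "eval_free scale \<phi> (p ^ n) = eval_free scale \<phi> p ^ n"
  by (induction n) (auto simp: eval_free_1 eval_free_mult)

lemmas eval_free_simps = eval_free_gen eval_free_const eval_free_0 eval_free_1 eval_free_add
  eval_free_diff eval_free_uminus eval_free_mult eval_free_power

lemma presents_relations:
  assumes "presents scale \<phi> E"
  shows "\<forall>(l, r)\<in>E. eval_free scale \<phi> l = eval_free scale \<phi> r"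
proof clarify
  fix l r assume "(l, r) \<in> E"
  then have "l - r \<in> relation_ideal E"
    unfolding relation_ideal_def by blast
  then have "l - r \<in> {p. eval_free scale \<phi> p = 0}"
    using assms by (simp add: presents_def)
  then show "eval_free scale \<phi> l = eval_free scale \<phi> r" by (simp add: eval_free_diff)
qed

text \<open>A presented algebra is the free cyclic module among those on which the relations hold: an element
  is sent to the action of any of its preimages in the free algebra, and two preimages differ by an
  element of the relation ideal, which acts as zero.\<close>

lemma presents_module_map:
  assumes "presents scale \<phi> E" and "free_algebra_module sc \<rho>"
    and rel: "\<And>l r v. (l, r) \<in> E \<Longrightarrow> act sc \<rho> l v = act sc \<rho> r v"
  obtains T where "Vector_Spaces.linear scale sc T" "T 1 = v" "\<And>c a. T (\<phi> c * a) = \<rho> c (T a)"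
proof -
  interpret M: free_algebra_module sc \<rho> by fact
  define lift where "lift = (\<lambda>a. SOME p. eval_free scale \<phi> p = a)"
  have lift: "eval_free scale \<phi> (lift a) = a" for a
    unfolding lift_def using assms(1) unfolding presents_def by (metis (mono_tags, lifting) someI_ex surjD)
  define T where "T a = act sc \<rho> (lift a) v" for a
  have T: "T (eval_free scale \<phi> p) = act sc \<rho> p v" for p
  proof -
    have "eval_free scale \<phi> (lift (eval_free scale \<phi> p) - p) = 0"
      by (simp add: eval_free_diff lift)
    then have "lift (eval_free scale \<phi> p) - p \<in> relation_ideal E"
      using assms(1) by (auto simp: presents_def)
    from M.act_relation_ideal[OF rel this] show ?thesis
      by (simp add: T_def M.act_diff)
  qed
  show ?thesis
  proof (rule that)
    show "T 1 = v" using T[of 1] by (simp add: eval_free_1 M.act_1)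
    show "T (\<phi> c * a) = \<rho> c (T a)" for c a
      using T[of "gen c * lift a"] T[of "lift a"]
      by (simp add: eval_free_mult eval_free_gen M.act_mult M.act_gen lift)
    have "T (a + b) = T a + T b" for a b
      using T[of "lift a + lift b"] T[of "lift a"] T[of "lift b"]
      by (simp add: eval_free_add M.act_add lift)
    moreover have "T (scale r a) = sc r (T a)" for r a
      using T[of "pm_scale r (lift a)"] T[of "lift a"]
      by (simp add: eval_free_pm_scale M.act_pm_scale lift)
    ultimately show "Vector_Spaces.linear scale sc T"
      by (intro Vector_Spaces.linear.intro module_hom.intro module_hom_axioms.intro
          vector_space_axioms M.vector_space_axioms module_axioms M.module_axioms)
  qed
qed

text \<open>A subspace that contains \<open>1\<close> and is closed under left multiplication by the generators contains
  every word in them.\<close>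

lemma presents_span:
  assumes "presents scale \<phi> E" and "1 \<in> span B"
    and closed: "\<And>c b. b \<in> B \<Longrightarrow> \<phi> c * b \<in> span B"
  shows "span B = UNIV"
proof -
  have step: "\<phi> c * a \<in> span B" if "a \<in> span B" for c a
    using that
  proof (rule span_induct[where P = "\<lambda>a. \<phi> c * a \<in> span B"])
    show "subspace {a. \<phi> c * a \<in> span B}"
      by (auto simp: subspace_def distrib_left times_scale span_add span_scale span_zero)
  qed (rule closed)
  have "prod_list (map \<phi> cs) \<in> span B" for cs
    by (induction cs) (auto simp: assms(2) step)
  then have "eval_free scale \<phi> p \<in> span B" for p
    unfolding eval_free_def by (intro lin_ext_in_subspace) auto
  then show ?thesis using assms(1) unfolding presents_def by (metis UNIV_eq_I surjD)
qed

end

section \<open>Coordinates in dimension eight\<close>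

text \<open>Vectors are nested pairs, so that addition comes from the product type and operators can be
  written by pattern matching.\<close>

type_synonym 'k vec8 = "'k \<times> 'k \<times> 'k \<times> 'k \<times> 'k \<times> 'k \<times> 'k \<times> 'k"

fun scale8 :: "'k::field \<Rightarrow> 'k vec8 \<Rightarrow> 'k vec8" where
  "scale8 r (a0, a1, a2, a3, a4, a5, a6, a7) =
    (r * a0, r * a1, r * a2, r * a3, r * a4, r * a5, r * a6, r * a7)"

lemma vec8_cases:
  obtains a0 a1 a2 a3 a4 a5 a6 a7 where "(x :: 'k vec8) = (a0, a1, a2, a3, a4, a5, a6, a7)"
  by (cases x rule: prod_cases7) (auto intro: that)

lemma vector_space_scale8: "vector_space (scale8 :: 'k::field \<Rightarrow> _)"
proof
  fix r s :: 'k and x y :: "'k vec8"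
  show "scale8 r (x + y) = scale8 r x + scale8 r y"
    by (cases x rule: vec8_cases; cases y rule: vec8_cases) (simp only: scale8.simps add_Pair distrib_left)
  show "scale8 (r + s) x = scale8 r x + scale8 s x"
    by (cases x rule: vec8_cases) (simp only: scale8.simps add_Pair distrib_right)
  show "scale8 r (scale8 s x) = scale8 (r * s) x"
    by (cases x rule: vec8_cases) (simp only: scale8.simps mult.assoc)
  show "scale8 1 x = x"
    by (cases x rule: vec8_cases) (simp only: scale8.simps mult_1)
qed

interpretation vec8: vector_space scale8
  by (rule vector_space_scale8)

definition unit8 :: "'k::field vec8 list" where
  "unit8 = [(1,0,0,0,0,0,0,0), (0,1,0,0,0,0,0,0), (0,0,1,0,0,0,0,0), (0,0,0,1,0,0,0,0),
    (0,0,0,0,1,0,0,0), (0,0,0,0,0,1,0,0), (0,0,0,0,0,0,1,0), (0,0,0,0,0,0,0,1)]"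

lemma distinct_unit8: "distinct (unit8 :: 'k::field vec8 list)"
  by (simp add: unit8_def)

text \<open>A map to \<open>k\<^sup>8\<close> that takes the list to the unit vectors reads off the coefficients of a linear
  combination of the list.\<close>

lemma (in vector_space) is_basis_of_coordinates8:
  assumes "Vector_Spaces.linear scale scale8 T" "map T B = unit8" "span (set B) = UNIV"
  shows "is_basis scale B"
proof -
  have dist: "distinct B"
    using assms(2) by (metis distinct_map distinct_unit8)
  interpret T: Vector_Spaces.linear scale scale8 T by fact
  obtain b0 b1 b2 b3 b4 b5 b6 b7 where B: "B = [b0,b1,b2,b3,b4,b5,b6,b7]"
    using assms(2) by (auto simp: unit8_def map_eq_Cons_conv)
  have "\<not> dependent (set B)"
  proof
    assume "dependent (set B)"
    then obtain u where u: "\<exists>v\<in>set B. u v \<noteq> 0" "(\<Sum>v\<in>set B. scale (u v) v) = 0"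
      by (auto simp: dependent_finite)
    have "T (\<Sum>v\<in>set B. scale (u v) v) = (u b0, u b1, u b2, u b3, u b4, u b5, u b6, u b7)"
      using assms(2) dist by (simp add: B unit8_def T.add T.scale)
    with u show False by (auto simp: B zero_prod_def)
  qed
  with dist assms(3) show ?thesis by (simp add: is_basis_def)
qed

section \<open>Evaluating bilinear forms on the comultiplication\<close>

definition bilinear_form :: "('k::field \<Rightarrow> 'a::ab_group_add \<Rightarrow> 'a) \<Rightarrow> ('a \<Rightarrow> 'a \<Rightarrow> 'k) \<Rightarrow> bool" where
  "bilinear_form sc F \<longleftrightarrow>
     (\<forall>a a' b. F (a + a') b = F a b + F a' b) \<and> (\<forall>a b b'. F a (b + b') = F a b + F a b') \<and>
     (\<forall>r a b. F (sc r a) b = r * F a b) \<and> (\<forall>r a b. F a (sc r b) = r * F a b)"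

text \<open>In Sweedler notation, \<open>F(h\<^sub>1, h\<^sub>2)\<close>.\<close>

definition coev :: "('a \<Rightarrow> ('a \<times> 'a \<Rightarrow>\<^sub>0 'k::field)) \<Rightarrow> ('a \<Rightarrow> 'a \<Rightarrow> 'k) \<Rightarrow> 'a \<Rightarrow> 'k" where
  "coev \<Delta> F h = lin_ext (*) (\<lambda>(a, b). F a b) (\<Delta> h)"

lemma teq2_trans: "teq2 sc t u \<Longrightarrow> teq2 sc u v \<Longrightarrow> teq2 sc t v"
  unfolding teq2_def null2_def using pm.span_add[of "t - u" _ "u - v"] by simp

lemma teq2_lin_ext_form:
  assumes "bilinear_form sc F" "teq2 sc t u"
  shows "lin_ext (*) (\<lambda>(a, b). F a b) t = lin_ext (*) (\<lambda>(a, b). F a b) u"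
proof -
  have "lin_ext (*) (\<lambda>(a, b). F a b) (t - u) \<in> {0}"
    by (rule field.lin_ext_null2)
      (use assms in \<open>auto simp: bilinear_form_def teq2_def field.subspace_def\<close>)
  then show ?thesis by (simp add: field.lin_ext_diff)
qed

lemma (in vector_space) lin_ext_lin_ext:
  "lin_ext scale f (lin_ext pm_scale e t) = lin_ext scale (\<lambda>b. lin_ext scale f (e b)) t"
  by (induction t rule: poly_mapping_add_induct) (auto simp: lin_ext_add pm.lin_ext_add lin_ext_pm_scale)

lemma lin_ext_form_tmult:
  "lin_ext (*) (\<lambda>(a, b). F a b) (tmult t u) =
     lin_ext (*) (\<lambda>(a, b). lin_ext (*) (\<lambda>(c, d). F (a * c) (b * d)) u) t"
  by (simp add: tmult_def field.lin_ext_lin_ext pure_def case_prod_unfold)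

context k_algebra
begin

lemma bilinear_form_translate:
  "bilinear_form scale F \<Longrightarrow> bilinear_form scale (\<lambda>a b. F (p * a) (q * b))"
  by (simp add: bilinear_form_def distrib_left times_scale)

lemma bilinear_form_lin_ext_translate:
  assumes "bilinear_form scale F"
  shows "bilinear_form scale (\<lambda>p q. lin_ext (*) (\<lambda>(c, d). F (p * c) (q * d)) u)"
  using assms unfolding bilinear_form_def
  by (auto simp: distrib_right scale_times case_prod_unfold field.lin_ext_fun_add field.lin_ext_fun_scale)

lemma bilinear_form_tensor:
  assumes "Vector_Spaces.linear scale (*) f" "Vector_Spaces.linear scale (*) f'"
  shows "bilinear_form scale (\<lambda>a b. f a * f' b)"
proof -
  interpret f: Vector_Spaces.linear scale "(*)" f by fact
  interpret f': Vector_Spaces.linear scale "(*)" f' by fact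
  show ?thesis
    by (simp add: bilinear_form_def f.add f.scale f'.add f'.scale distrib_left distrib_right)
qed

lemma bilinear_form_tensor_right:
  assumes "Vector_Spaces.linear scale (*) f" "Vector_Spaces.linear scale (*) f'"
  shows "bilinear_form scale (\<lambda>a b. f a * f' (b * k))"
proof -
  interpret f: Vector_Spaces.linear scale "(*)" f by fact
  interpret f': Vector_Spaces.linear scale "(*)" f' by fact
  show ?thesis
    by (simp add: bilinear_form_def f.add f.scale f'.add f'.scale distrib_left distrib_right
        scale_times)
qed

text \<open>The product of tensors respects the tensor relations in each factor. It is needed for products of
  group-likes to be group-like, where an identity of tensors has to be proved and values of bilinear
  forms do not suffice as they stand.\<close>

lemma tmult_teq2:
  assumes "teq2 scale t t'" "teq2 scale u u'"
  shows "teq2 scale (tmult t u) (tmult t' u')"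
proof -
  have sub: "pm.subspace (null2 scale)"
    unfolding null2_def by (rule pm.subspace_span)
  have pure_null2:
    "(a + a') \<otimes> b - a \<otimes> b - a' \<otimes> b \<in> null2 scale"
    "a \<otimes> (b + b') - a \<otimes> b - a \<otimes> b' \<in> null2 scale"
    "scale r a \<otimes> b - pm_scale r (a \<otimes> b) \<in> null2 scale"
    "a \<otimes> scale r b - pm_scale r (a \<otimes> b) \<in> null2 scale" for a a' b b' r
    unfolding null2_def by (rule pm.span_base, blast)+
  let ?R = "\<lambda>u (a, b). lin_ext pm_scale (\<lambda>(c, d). (a * c) \<otimes> (b * d)) u"
  have right: "?R (u - u') (a, b) \<in> null2 scale" for a b
    using assms(2) unfolding teq2_def case_prod_conv
    by (intro pm.lin_ext_null2[OF sub])
      (auto simp: distrib_left times_scale pure_null2)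
  have "tmult t u - tmult t u' = lin_ext pm_scale (?R (u - u')) t"
    by (simp add: tmult_def lin_ext_def pm.lin_ext_diff[unfolded lin_ext_def] case_prod_unfold
        sum_subtractf[symmetric] pm.scale_right_diff_distrib)
  also have "\<dots> \<in> null2 scale"
    using right by (intro pm.lin_ext_in_subspace[OF sub]) auto
  finally have "teq2 scale (tmult t u) (tmult t u')"
    by (simp add: teq2_def)
  moreover have "teq2 scale (tmult t u') (tmult t' u')"
  proof -
    have "lin_ext pm_scale (?R u') (t - t') \<in> null2 scale"
    proof (rule pm.lin_ext_null2[OF sub _ _ _ _ assms(1)[unfolded teq2_def]])
      show "?R u' (a + a', b) - ?R u' (a, b) - ?R u' (a', b) \<in> null2 scale" for a a' b
      proof -
        have "?R u' (a + a', b) - ?R u' (a, b) - ?R u' (a', b) = lin_ext pm_scale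
            (\<lambda>(c, d). ((a + a') * c) \<otimes> (b * d) - (a * c) \<otimes> (b * d) - (a' * c) \<otimes> (b * d)) u'"
          by (simp add: lin_ext_def case_prod_unfold sum_subtractf pm.scale_right_diff_distrib)
        also have "\<dots> \<in> null2 scale"
          by (intro pm.lin_ext_in_subspace[OF sub]) (auto simp: distrib_right pure_null2)
        finally show ?thesis .
      qed
      show "?R u' (a, b + b') - ?R u' (a, b) - ?R u' (a, b') \<in> null2 scale" for a b b'
      proof -
        have "?R u' (a, b + b') - ?R u' (a, b) - ?R u' (a, b') = lin_ext pm_scale
            (\<lambda>(c, d). (a * c) \<otimes> ((b + b') * d) - (a * c) \<otimes> (b * d) - (a * c) \<otimes> (b' * d)) u'"
          by (simp add: lin_ext_def case_prod_unfold sum_subtractf pm.scale_right_diff_distrib)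
        also have "\<dots> \<in> null2 scale"
          by (intro pm.lin_ext_in_subspace[OF sub]) (auto simp: distrib_right pure_null2)
        finally show ?thesis .
      qed
      show "?R u' (scale r a, b) - pm_scale r (?R u' (a, b)) \<in> null2 scale" for r a b
      proof -
        have "?R u' (scale r a, b) - pm_scale r (?R u' (a, b)) = lin_ext pm_scale
            (\<lambda>(c, d). (scale r a * c) \<otimes> (b * d) - pm_scale r ((a * c) \<otimes> (b * d))) u'"
          by (simp add: lin_ext_def case_prod_unfold sum_subtractf pm.scale_right_diff_distrib
              pm.scale_sum_right mult.commute)
        also have "\<dots> \<in> null2 scale"
          by (intro pm.lin_ext_in_subspace[OF sub]) (auto simp: scale_times pure_null2)
        finally show ?thesis .
      qed
      show "?R u' (a, scale r b) - pm_scale r (?R u' (a, b)) \<in> null2 scale" for r a b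
      proof -
        have "?R u' (a, scale r b) - pm_scale r (?R u' (a, b)) = lin_ext pm_scale
            (\<lambda>(c, d). (a * c) \<otimes> (scale r b * d) - pm_scale r ((a * c) \<otimes> (b * d))) u'"
          by (simp add: lin_ext_def case_prod_unfold sum_subtractf pm.scale_right_diff_distrib
              pm.scale_sum_right mult.commute)
        also have "\<dots> \<in> null2 scale"
          by (intro pm.lin_ext_in_subspace[OF sub]) (auto simp: scale_times pure_null2)
        finally show ?thesis .
      qed
    qed
    then show ?thesis by (simp add: teq2_def tmult_def pm.lin_ext_diff)
  qed
  ultimately show ?thesis by (rule teq2_trans)
qed

lemma tmult_pure: "tmult (a \<otimes> b) (c \<otimes> d) = (a * c) \<otimes> (b * d)"
  by (simp add: tmult_def pure_def)

end

text \<open>\<open>\<Delta> h = h \<otimes> u + v \<otimes> h\<close>, as seen by bilinear forms. Unlike the elements of \<open>P\<^sub>1\<^sub>,\<^sub>s\<close>, these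
  elements are closed under left multiplication by group-likes.\<close>

definition is_skew :: "('k::field \<Rightarrow> 'a::ring_1 \<Rightarrow> 'a) \<Rightarrow> ('a \<Rightarrow> ('a \<times> 'a \<Rightarrow>\<^sub>0 'k)) \<Rightarrow> 'a \<Rightarrow> 'a \<Rightarrow> 'a \<Rightarrow> bool"
  where "is_skew sc \<Delta> u v h \<longleftrightarrow> (\<forall>F. bilinear_form sc F \<longrightarrow> coev \<Delta> F h = F h u + F v h)"

lemma is_skew_coev: "is_skew sc \<Delta> u v h \<Longrightarrow> bilinear_form sc F \<Longrightarrow> coev \<Delta> F h = F h u + F v h"
  by (simp add: is_skew_def)

context hopf_algebra
begin

sublocale k_algebra scale
  by unfold_locales (fact scale_mult_left scale_mult_right)+

lemma coev_add: "bilinear_form scale F \<Longrightarrow> coev \<Delta> F (a + b) = coev \<Delta> F a + coev \<Delta> F b"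
  unfolding coev_def using teq2_lin_ext_form[OF _ comult_add, of F a b]
  by (simp add: field.lin_ext_add)

lemma coev_scale: "bilinear_form scale F \<Longrightarrow> coev \<Delta> F (scale r a) = r * coev \<Delta> F a"
  unfolding coev_def using teq2_lin_ext_form[OF _ comult_scale, of F r a]
  by (simp add: field.lin_ext_pm_scale)

lemma linear_coev: "bilinear_form scale F \<Longrightarrow> Vector_Spaces.linear scale (*) (coev \<Delta> F)"
  by (intro Vector_Spaces.linear.intro module_hom.intro module_hom_axioms.intro
      vector_space_axioms vector_space_mult module_axioms field.module_axioms coev_add coev_scale)

lemma coev_mult:
  assumes "bilinear_form scale F"
  shows "coev \<Delta> F (a * b) = coev \<Delta> (\<lambda>p q. coev \<Delta> (\<lambda>r s. F (p * r) (q * s)) b) a"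
  unfolding coev_def using teq2_lin_ext_form[OF assms comult_mult, of a b]
  by (simp add: lin_ext_form_tmult)

lemma coev_group_like:
  "group_like scale \<Delta> u \<Longrightarrow> bilinear_form scale F \<Longrightarrow> coev \<Delta> F u = F u u"
  unfolding coev_def group_like_def using teq2_lin_ext_form[of scale F "\<Delta> u" "u \<otimes> u"]
  by (simp add: pure_def)

lemma is_skew_skew_primitive:
  "skew_primitive scale \<Delta> s x \<Longrightarrow> is_skew scale \<Delta> 1 s x"
  unfolding is_skew_def coev_def skew_primitive_def
  using teq2_lin_ext_form[of scale _ "\<Delta> x" "x \<otimes> 1 + s \<otimes> x"]
  by (simp add: pure_def field.lin_ext_add)

lemma bilinear_form_coev_translate:
  assumes "bilinear_form scale F"
  shows "bilinear_form scale (\<lambda>p q. coev \<Delta> (\<lambda>r s. F (p * r) (q * s)) b)"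
  unfolding coev_def by (rule bilinear_form_lin_ext_translate[OF assms])

lemma is_skew_mult_left:
  assumes u: "group_like scale \<Delta> u" and h: "is_skew scale \<Delta> v w h"
  shows "is_skew scale \<Delta> (u * v) (u * w) (u * h)"
  unfolding is_skew_def
proof (intro allI impI)
  fix F assume F: "bilinear_form scale F"
  have "coev \<Delta> F (u * h) = coev \<Delta> (\<lambda>r s. F (u * r) (u * s)) h"
    unfolding coev_mult[OF F]
    by (rule coev_group_like[OF u bilinear_form_coev_translate[OF F]])
  also have "\<dots> = F (u * h) (u * v) + F (u * w) (u * h)"
    using h bilinear_form_translate[OF F] by (simp add: is_skew_def)
  finally show "coev \<Delta> F (u * h) = F (u * h) (u * v) + F (u * w) (u * h)" .
qed

lemma one_neq_zero: "(1::'a) \<noteq> 0"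
proof
  interpret \<epsilon>: Vector_Spaces.linear scale "(*)" \<epsilon> by (rule counit_linear)
  assume "(1::'a) = 0"
  then have "\<epsilon> 1 = \<epsilon> (scale 0 1)" by simp
  also have "\<dots> = 0 * \<epsilon> 1"
    by (rule \<epsilon>.scale)
  finally show False by (simp add: counit_one)
qed

lemma group_like_one: "group_like scale \<Delta> 1"
  unfolding group_like_def using comult_one one_neq_zero by simp

lemma group_like_mult:
  assumes "group_like scale \<Delta> u" "group_like scale \<Delta> v" "u * v \<noteq> 0"
  shows "group_like scale \<Delta> (u * v)"
  using assms teq2_trans[OF comult_mult tmult_teq2, of u "u \<otimes> u" v "v \<otimes> v"]
  by (simp add: group_like_def tmult_pure)

text \<open>The counit law sends \<open>u \<otimes> u\<close> to \<open>\<epsilon>(u) u\<close>, which must be \<open>u\<close>.\<close>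

lemma counit_group_like:
  assumes "group_like scale \<Delta> u"
  shows "\<epsilon> u = 1"
proof -
  interpret \<epsilon>: Vector_Spaces.linear scale "(*)" \<epsilon> by (rule counit_linear)
  have "lin_ext scale (\<lambda>(a, b). scale (\<epsilon> a) b) (\<Delta> u - u \<otimes> u) \<in> {0}"
    by (rule lin_ext_null2)
      (use assms in \<open>auto simp: group_like_def teq2_def \<epsilon>.add \<epsilon>.scale scale_left_distrib
        scale_right_distrib mult.commute\<close>)
  then have "scale (\<epsilon> u) u = scale 1 u"
    by (simp add: lin_ext_diff counit_left pure_def)
  then show ?thesis
    using assms by (simp add: group_like_def scale_cancel_right del: scale_one)
qed

text \<open>The counit law after applying \<open>\<epsilon>\<close> to it.\<close>

lemma coev_counit: "coev \<Delta> (\<lambda>a b. \<epsilon> a * \<epsilon> b) h = \<epsilon> h"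
proof -
  interpret \<epsilon>: Vector_Spaces.linear scale "(*)" \<epsilon> by (rule counit_linear)
  have "\<epsilon> h = \<epsilon> (lin_ext scale (\<lambda>(a, b). scale (\<epsilon> a) b) (\<Delta> h))"
    by (simp add: counit_left)
  also have "\<dots> = coev \<Delta> (\<lambda>a b. \<epsilon> a * \<epsilon> b) h"
    by (simp add: coev_def lin_ext_def \<epsilon>.sum \<epsilon>.scale case_prod_unfold mult.assoc)
  finally show ?thesis by simp
qed

text \<open>Here \<open>\<epsilon>(h\<^sub>1) \<epsilon>(h\<^sub>2) = \<epsilon>(h)\<close> becomes \<open>\<epsilon>(h) + \<epsilon>(h) = \<epsilon>(h)\<close>.\<close>

lemma counit_skew:
  assumes "is_skew scale \<Delta> u v h" "group_like scale \<Delta> u" "group_like scale \<Delta> v"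
  shows "\<epsilon> h = 0"
proof -
  have "\<epsilon> h = \<epsilon> h * \<epsilon> u + \<epsilon> v * \<epsilon> h"
    using coev_counit[of h] assms(1) bilinear_form_tensor[OF counit_linear counit_linear]
    unfolding is_skew_def by metis
  then have "\<epsilon> h + 0 = \<epsilon> h + \<epsilon> h"
    by (simp only: counit_group_like assms(2,3) mult_1 mult_1_right add_0_right)
  then show ?thesis by (simp only: add_left_cancel)
qed

lemma partial_action_counit: "partial_action scale \<Delta> \<epsilon>"
  unfolding partial_action_def
proof (intro conjI allI counit_linear counit_one)
  fix h k
  have "lin_ext (*) (\<lambda>(a, b). \<epsilon> a * \<epsilon> (b * k)) (\<Delta> h) = coev \<Delta> (\<lambda>a b. \<epsilon> a * \<epsilon> b) h * \<epsilon> k"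
    unfolding coev_def lin_ext_def sum_distrib_right
    by (intro sum.cong refl) (simp add: counit_mult case_prod_unfold)
  then show "\<epsilon> h * \<epsilon> k = lin_ext (*) (\<lambda>(a, b). \<epsilon> a * \<epsilon> (b * k)) (\<Delta> h)"
    by (simp add: coev_counit)
qed

lemma partial_action_coev:
  "partial_action scale \<Delta> lam \<Longrightarrow> lam h * lam k = coev \<Delta> (\<lambda>a b. lam a * lam (b * k)) h"
  unfolding partial_action_def coev_def by blast

lemma bilinear_form_partial_action:
  "partial_action scale \<Delta> lam \<Longrightarrow> bilinear_form scale (\<lambda>a b. lam a * lam (b * k))"
  unfolding partial_action_def by (blast intro: bilinear_form_tensor_right)

lemma partial_action_group_like:
  assumes "partial_action scale \<Delta> lam" "group_like scale \<Delta> u"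
  shows "lam u * lam k = lam u * lam (u * k)"
  using partial_action_coev[OF assms(1), of u k]
    coev_group_like[OF assms(2) bilinear_form_partial_action[OF assms(1), of k]]
  by (rule trans)

lemma partial_action_skew:
  assumes "partial_action scale \<Delta> lam" "is_skew scale \<Delta> u v h"
  shows "lam h * lam k = lam h * lam (u * k) + lam v * lam (h * k)"
  using partial_action_coev[OF assms(1), of h k] assms(2)
    bilinear_form_partial_action[OF assms(1), of k]
  unfolding is_skew_def by metis

lemma linear_eq_on_basis:
  assumes "is_basis scale B" "Vector_Spaces.linear scale (*) f" "Vector_Spaces.linear scale (*) f'"
    and "\<And>b. b \<in> set B \<Longrightarrow> f b = f' b"
  shows "f = f'"
proof -
  interpret pair: vector_space_pair scale "(*) :: 'k \<Rightarrow> _"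
    by (intro vector_space_pair.intro vector_space_axioms vector_space_mult)
  have "f a = f' a" for a
    using pair.linear_eq_on_span[OF assms(2,3), of "set B" a] assms(1,4)
    by (simp add: is_basis_def)
  then show ?thesis by blast
qed

lemma has_values_unique:
  assumes "is_basis scale B" "has_values scale B f vs" "has_values scale B f' vs"
  shows "f = f'"
  using assms by (intro linear_eq_on_basis[of B]) (auto simp: has_values_def)

text \<open>Both sides of the defining equation are linear in \<open>h\<close> and in \<open>k\<close>.\<close>

lemma partial_action_basisI:
  assumes B: "is_basis scale B" and lin: "Vector_Spaces.linear scale (*) lam" and one: "lam 1 = 1"
    and eq: "\<And>h k. h \<in> set B \<Longrightarrow> k \<in> set B \<Longrightarrow>
      lam h * lam k = coev \<Delta> (\<lambda>a b. lam a * lam (b * k)) h"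
  shows "partial_action scale \<Delta> lam"
proof -
  interpret lam: Vector_Spaces.linear scale "(*)" lam by fact
  have lin_mult: "Vector_Spaces.linear scale (*) (\<lambda>h. f h * r)"
    if "Vector_Spaces.linear scale (*) f" for f and r :: 'k
  proof -
    interpret f: Vector_Spaces.linear scale "(*)" f by fact
    show ?thesis
      by unfold_locales (simp_all add: f.add f.scale distrib_right)
  qed
  have h: "(\<lambda>h. lam h * lam k) = (\<lambda>h. coev \<Delta> (\<lambda>a b. lam a * lam (b * k)) h)" if "k \<in> set B" for k
    using eq[OF _ that]
    by (intro linear_eq_on_basis[OF B lin_mult[OF lin]] linear_coev bilinear_form_tensor_right lin)
  have "(\<lambda>k. lam k * lam h) = (\<lambda>k. coev \<Delta> (\<lambda>a b. lam a * lam (b * k)) h)" for h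
  proof (rule linear_eq_on_basis[OF B lin_mult[OF lin]])
    show "Vector_Spaces.linear scale (*) (\<lambda>k. coev \<Delta> (\<lambda>a b. lam a * lam (b * k)) h)"
    proof unfold_locales
      fix r :: 'k and k k' :: 'a
      show "coev \<Delta> (\<lambda>a b. lam a * lam (b * (k + k'))) h =
          coev \<Delta> (\<lambda>a b. lam a * lam (b * k)) h + coev \<Delta> (\<lambda>a b. lam a * lam (b * k')) h"
        unfolding coev_def case_prod_unfold
        by (simp only: distrib_left lam.add field.lin_ext_fun_add)
      show "coev \<Delta> (\<lambda>a b. lam a * lam (b * scale r k)) h =
          r * coev \<Delta> (\<lambda>a b. lam a * lam (b * k)) h"
        unfolding coev_def case_prod_unfold
        by (simp only: times_scale lam.scale mult.left_commute[of _ r] field.lin_ext_fun_scale)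
    qed
  qed (use h in \<open>auto simp: fun_eq_iff mult.commute\<close>)
  then have "lam h * lam k = coev \<Delta> (\<lambda>a b. lam a * lam (b * k)) h" for h k
    by (subst mult.commute) (rule fun_cong)
  with lin one show ?thesis unfolding partial_action_def coev_def by blast
qed

text \<open>\<open>\<Delta> h\<close> is a combination of tensors of basis elements that are neither of the form \<open>b \<otimes> b\<close> nor in
  \<open>G \<otimes> G\<close>.\<close>

definition off_diagonal :: "'a set \<Rightarrow> 'a set \<Rightarrow> 'a \<Rightarrow> bool" where
  "off_diagonal B G h \<longleftrightarrow> (\<exists>ps :: ('k \<times> 'a \<times> 'a) list.
     (\<forall>(r, a, b)\<in>set ps. a \<in> B \<and> b \<in> B \<and> a \<noteq> b \<and> \<not> (a \<in> G \<and> b \<in> G)) \<and>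
     (\<forall>F. bilinear_form scale F \<longrightarrow> coev \<Delta> F h = (\<Sum>(r, a, b)\<leftarrow>ps. r * F a b)))"

lemma off_diagonal_skew:
  assumes "is_skew scale \<Delta> u v h" "u \<in> G" "v \<in> G" "h \<in> B - G" "G \<subseteq> B"
  shows "off_diagonal B G h"
  unfolding off_diagonal_def
  by (rule exI[of _ "[(1, h, u), (1, v, h)]"]) (use assms in \<open>auto simp: is_skew_def\<close>)

text \<open>Write \<open>c\<^sub>b\<close> for the coefficients of a group-like \<open>u\<close>. Comparing the coefficients of \<open>p \<otimes> q\<close> in
  \<open>\<Delta> u = u \<otimes> u\<close> for \<open>p = q\<close> or \<open>p, q \<in> G\<close>, the basis elements outside \<open>G\<close> do not contribute on the
  left: so \<open>c\<^sub>p\<^sup>2 = 0\<close> for \<open>p\<close> outside \<open>G\<close>, and the coefficients on \<open>G\<close> are orthogonal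
  idempotents of the field. Only one of them is \<open>1\<close>.\<close>

lemma group_like_iff_in_basis:
  assumes B: "is_basis scale B" and "G \<subseteq> set B"
    and G: "\<And>u. u \<in> G \<Longrightarrow> group_like scale \<Delta> u"
    and off: "\<And>h. h \<in> set B - G \<Longrightarrow> off_diagonal (set B) G h"
  shows "group_like scale \<Delta> u \<longleftrightarrow> u \<in> G"
proof
  assume u: "group_like scale \<Delta> u"
  let ?c = "\<lambda>p a. representation (set B) a p"
  have indep: "independent (set B)" and span: "span (set B) = UNIV"
    using B by (auto simp: is_basis_def)
  have lin: "Vector_Spaces.linear scale (*) (?c p)" for p
    by unfold_locales (simp_all add: representation_add representation_scale indep span)
  have basis: "?c p b = (if b = p then 1 else 0)" if "b \<in> set B" for p b
    using that by (simp add: representation_basis indep)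
  have expand: "u = (\<Sum>b\<in>set B. scale (?c b u) b)"
    using sum_representation_eq[OF indep, of u "set B"] by (simp add: span)
  have coeff: "?c p u * ?c q u = (if p = q \<and> p \<in> G then ?c p u else 0)"
    if "p \<in> set B" "q \<in> set B" "p = q \<or> p \<in> G \<and> q \<in> G" for p q
  proof -
    let ?F = "\<lambda>a b. ?c p a * ?c q b"
    have F: "bilinear_form scale ?F"
      by (intro bilinear_form_tensor lin)
    interpret E: Vector_Spaces.linear scale "(*)" "coev \<Delta> ?F" by (rule linear_coev[OF F])
    have off0: "coev \<Delta> ?F h = 0" if h: "h \<in> set B - G" for h
    proof -
      from off[OF h] obtain ps :: "('k \<times> 'a \<times> 'a) list" where
        ps: "\<forall>(r, a, b)\<in>set ps. a \<in> set B \<and> b \<in> set B \<and> a \<noteq> b \<and> \<not> (a \<in> G \<and> b \<in> G)"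
        and eq: "coev \<Delta> ?F h = (\<Sum>(r, a, b)\<leftarrow>ps. r * ?F a b)"
        using F unfolding off_diagonal_def by blast
      have "(\<Sum>(r, a, b)\<leftarrow>ps. r * ?F a b) = (\<Sum>_\<leftarrow>ps. 0)"
        using ps that \<open>p = q \<or> p \<in> G \<and> q \<in> G\<close>
        by (intro arg_cong[of _ _ sum_list] map_cong) (auto simp: basis split: if_splits)
      with eq show ?thesis by simp
    qed
    have "?c p u * ?c q u = coev \<Delta> ?F (\<Sum>b\<in>set B. scale (?c b u) b)"
      using coev_group_like[OF u F] expand by simp
    also have "\<dots> = (\<Sum>b\<in>set B. ?c b u * coev \<Delta> ?F b)"
      by (simp add: E.sum E.scale)
    also have "\<dots> = (\<Sum>b\<in>set B. if b = p then (if p = q \<and> p \<in> G then ?c p u else 0) else 0)"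
    proof (rule sum.cong[OF refl])
      fix b assume b: "b \<in> set B"
      show "?c b u * coev \<Delta> ?F b = (if b = p then (if p = q \<and> p \<in> G then ?c p u else 0) else 0)"
        using coev_group_like[OF G F, of b] off0[of b] b by (cases "b \<in> G") (auto simp: basis)
    qed
    also have "\<dots> = (if p = q \<and> p \<in> G then ?c p u else 0)"
      using that by simp
    finally show ?thesis .
  qed
  have "\<exists>p\<in>set B. ?c p u \<noteq> 0"
  proof (rule ccontr)
    assume "\<not> ?thesis"
    then have "(\<Sum>b\<in>set B. scale (?c b u) b) = 0" by simp
    with expand u show False by (simp add: group_like_def)
  qed
  then obtain p where p: "p \<in> set B" "?c p u \<noteq> 0" by blast
  then have "p \<in> G" using coeff[of p p] by (auto split: if_splits)
  have "?c p u = 1" using coeff[of p p] p \<open>p \<in> G\<close> by simp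
  have "?c q u = 0" if "q \<in> set B" "q \<noteq> p" for q
    using coeff[of q q] coeff[of p q] p that \<open>p \<in> G\<close> by (cases "q \<in> G") auto
  then have "(\<Sum>b\<in>set B. scale (?c b u) b) = (\<Sum>b\<in>set B. if b = p then p else 0)"
    using \<open>?c p u = 1\<close> by (intro sum.cong) auto
  with expand p have "u = p" by simp
  with \<open>p \<in> G\<close> show "u \<in> G" by simp
qed (rule G)

end

section \<open>One skew-primitive generator over a group of group-likes\<close>

text \<open>The common shape of all the algebras except \<open>\<A>\<^sub>2\<close>: as a vector space \<open>k[G] \<oplus> k[G] x\<close> with
  a skew-primitive \<open>x\<close>.\<close>

locale rank_one_hopf = hopf_algebra scale \<Delta> \<epsilon> S
  for scale :: "'k::field \<Rightarrow> 'a::ring_1 \<Rightarrow> 'a" and \<Delta> \<epsilon> S +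
  fixes B :: "'a list" and G :: "'a set" and s x :: 'a
  assumes basis: "is_basis scale B"
    and set_B: "set B = G \<union> (\<lambda>u. u * x) ` G"
    and disjoint: "G \<inter> (\<lambda>u. u * x) ` G = {}"
    and one_in: "1 \<in> G" and s_in: "s \<in> G"
    and mult_in: "u \<in> G \<Longrightarrow> v \<in> G \<Longrightarrow> u * v \<in> G"
    and group_like: "u \<in> G \<Longrightarrow> group_like scale \<Delta> u"
    and skew_x: "is_skew scale \<Delta> 1 s x"
begin

lemma is_skew_mult_x: "u \<in> G \<Longrightarrow> is_skew scale \<Delta> u (u * s) (u * x)"
  using is_skew_mult_left[OF group_like skew_x, of u] by simp

lemma group_like_iff: "group_like scale \<Delta> u \<longleftrightarrow> u \<in> G"
proof (rule group_like_iff_in_basis[OF basis])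
  fix h assume "h \<in> set B - G"
  then obtain u where "u \<in> G" "h = u * x" using set_B by blast
  with \<open>h \<in> set B - G\<close> show "off_diagonal (set B) G h"
    using is_skew_mult_x mult_in s_in set_B by (intro off_diagonal_skew[of u "u * s"]) auto
qed (use set_B group_like in auto)

lemma unit_locus_eq: "unit_locus scale \<Delta> lam = {u \<in> G. lam u = 1}"
  by (auto simp: unit_locus_def group_like_iff)

lemma counit_G: "u \<in> G \<Longrightarrow> \<epsilon> u = 1"
  by (rule counit_group_like[OF group_like])

lemma counit_G_x: "u \<in> G \<Longrightarrow> \<epsilon> (u * x) = 0"
  by (rule counit_skew[OF is_skew_mult_x]) (auto intro: group_like mult_in s_in)

text \<open>The basis consists of the \<open>u\<close> and the \<open>u x\<close> with \<open>u \<in> G\<close>, and \<open>\<Delta>(u x) = u x \<otimes> u + u s \<otimes> u x\<close>.\<close>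

lemma partial_action_iff:
  "partial_action scale \<Delta> lam \<longleftrightarrow> Vector_Spaces.linear scale (*) lam \<and> lam 1 = 1 \<and>
     (\<forall>u\<in>G. \<forall>k\<in>set B. lam u * lam k = lam u * lam (u * k) \<and>
        lam (u * x) * lam k = lam (u * x) * lam (u * k) + lam (u * s) * lam (u * x * k))"
  (is "_ \<longleftrightarrow> ?R")
proof
  assume "partial_action scale \<Delta> lam"
  then show ?R
    using partial_action_group_like[OF _ group_like] partial_action_skew[OF _ is_skew_mult_x]
    unfolding partial_action_def by blast
next
  assume R: ?R
  show "partial_action scale \<Delta> lam"
  proof (rule partial_action_basisI[OF basis])
    fix h k assume h: "h \<in> set B" and k: "k \<in> set B"
    have F: "bilinear_form scale (\<lambda>a b. lam a * lam (b * k))"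
      using R by (blast intro: bilinear_form_tensor_right)
    from h set_B consider "h \<in> G" | u where "u \<in> G" "h = u * x" by blast
    then show "lam h * lam k = coev \<Delta> (\<lambda>a b. lam a * lam (b * k)) h"
    proof cases
      case 1
      show ?thesis
        unfolding coev_group_like[OF group_like[OF 1] F] using R 1 k by blast
    next
      case 2
      have "coev \<Delta> (\<lambda>a b. lam a * lam (b * k)) h =
          lam (u * x) * lam (u * k) + lam (u * s) * lam (u * x * k)"
        using is_skew_mult_x[OF 2(1)] F 2(2) unfolding is_skew_def by blast
      then show ?thesis using R 2 k by metis
    qed
  qed (use R in blast)+
qed

end

section \<open>The group-likes form a cyclic group of order four\<close>

text \<open>The left regular representation in the basis \<open>1, g, g\<^sup>2, g\<^sup>3, x, g x, g\<^sup>2 x, g\<^sup>3 x\<close>: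
  \<open>g\<close> shifts both halves cyclically, and \<open>x g\<^sup>i = c\<^sup>i g\<^sup>i x\<close> while
  \<open>x g\<^sup>i x = c\<^sup>i t (g\<^sup>i\<^sup>+\<^sup>2 - g\<^sup>i)\<close>.\<close>

fun cyc_g :: "'k::field vec8 \<Rightarrow> 'k vec8" where
  "cyc_g (a0, a1, a2, a3, b0, b1, b2, b3) = (a3, a0, a1, a2, b3, b0, b1, b2)"

fun cyc_x :: "'k::field \<Rightarrow> 'k \<Rightarrow> 'k vec8 \<Rightarrow> 'k vec8" where
  "cyc_x c t (a0, a1, a2, a3, b0, b1, b2, b3) =
     (t * (c^2 * b2 - b0), t * (c^3 * b3 - c * b1), t * (b0 - c^2 * b2), t * (c * b1 - c^3 * b3),
      a0, c * a1, c^2 * a2, c^3 * a3)"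

lemma cyc_module: "free_algebra_module scale8 (case_gx cyc_g (cyc_x c t))"
proof
  fix l r v w
  show "case_gx cyc_g (cyc_x c t) l (v + w) =
      case_gx cyc_g (cyc_x c t) l v + case_gx cyc_g (cyc_x c t) l w"
    by (cases l; cases v rule: vec8_cases; cases w rule: vec8_cases; hypsubst;
        simp only: gx.case cyc_g.simps cyc_x.simps add_Pair prod.inject; intro conjI;
        simp only: distrib_left right_diff_distrib add_diff_add)
  show "case_gx cyc_g (cyc_x c t) l (scale8 r v) = scale8 r (case_gx cyc_g (cyc_x c t) l v)"
    by (cases l; cases v rule: vec8_cases; hypsubst;
        simp only: gx.case cyc_g.simps cyc_x.simps scale8.simps prod.inject; intro conjI;
        simp only: right_diff_distrib mult.left_commute[of _ r])
qed

locale cyclic4 = k_algebra scale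
  for scale :: "'k::field \<Rightarrow> 'a::ring_1 \<Rightarrow> 'a" +
  fixes g x :: 'a and c t :: 'k
  assumes g_pow4: "g ^ 4 = 1"
    and x_g: "x * g = scale c (g * x)"
    and x_x: "x * x = scale t (g ^ 2 - 1)"
begin

abbreviation B :: "'a list" where
  "B \<equiv> [1, g, g ^ 2, g ^ 3, x, g * x, g ^ 2 * x, g ^ 3 * x]"

lemma g_cycle: "g * (g * (g * g)) = 1" "g * (g * (g * (g * a))) = a"
  using g_pow4 by (simp_all add: power4_eq_xxxx flip: mult.assoc)

lemma x_g_mult: "x * (g * a) = scale c (g * (x * a))"
  using x_g by (simp add: scale_times flip: mult.assoc)

lemma x_x_mult: "x * (x * a) = scale t (g * (g * a) - a)"
  using x_x by (simp add: scale_times left_diff_distrib power2_eq_square flip: mult.assoc)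

text \<open>These rules rewrite every product of generators to a multiple of \<open>g\<^sup>i x\<^sup>j\<close>, nested to the
  right.\<close>

lemmas normal_form = power2_eq_square[of g] power3_eq_cube[of g] mult.assoc g_cycle x_g x_g_mult
  x_x[unfolded power2_eq_square] x_x_mult scale_times times_scale right_diff_distrib[of g]
  right_diff_distrib[of x]

text \<open>\<open>c\<^sup>4 = 1\<close> and \<open>t c\<^sup>2 = t\<close> say that moving \<open>x\<close> past \<open>g\<^sup>4\<close>, and \<open>x\<^sup>2\<close> past \<open>g\<close>, is consistent with the
  relations; they are the conditions under which the operators above can satisfy them.\<close>

lemma basis_of_presentation:
  assumes pres: "presents scale (case_gx g x) E" and c: "c ^ 4 = 1" and t: "t * c ^ 2 = t"
    and rel: "\<And>l r v. (l, r) \<in> E \<Longrightarrow>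
      act scale8 (case_gx cyc_g (cyc_x c t)) l v = act scale8 (case_gx cyc_g (cyc_x c t)) r v"
  shows "is_basis scale B"
proof -
  obtain T where T: "Vector_Spaces.linear scale scale8 T" "T 1 = (1,0,0,0,0,0,0,0)"
    and T_mult: "\<And>l a. T (case_gx g x l * a) = case_gx cyc_g (cyc_x c t) l (T a)"
    using presents_module_map[OF pres cyc_module rel] by blast
  have Tg: "T (g * a) = cyc_g (T a)" and Tx: "T (x * a) = cyc_x c t (T a)" for a
    using T_mult[of Gx_g a] T_mult[of Gx_x a] by simp_all
  have "T g = cyc_g (T 1)" "T x = cyc_x c t (T 1)" using Tg[of 1] Tx[of 1] by simp_all
  then have gens: "T g = (0,1,0,0,0,0,0,0)" "T x = (0,0,0,0,1,0,0,0)"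
    by (simp_all only: T(2) cyc_g.simps cyc_x.simps mult_zero_right diff_self mult_1)
  have "map T B = unit8"
    by (simp only: list.map unit8_def power2_eq_square power3_eq_cube mult.assoc Tg gens T(2)
        cyc_g.simps)
  moreover have "span (set B) = UNIV"
  proof (rule presents_span[OF pres])
    fix l b assume b: "b \<in> set B"
    define M where "M = span (set B)"
    have mem: "1 \<in> M" "g \<in> M" "g * g \<in> M" "g * (g * g) \<in> M" "x \<in> M" "g * x \<in> M"
      "g * (g * x) \<in> M" "g * (g * (g * x)) \<in> M"
      unfolding M_def by (rule span_base, simp add: power2_eq_square power3_eq_cube mult.assoc)+
    have closed: "scale r a \<in> M" "a' \<in> M \<Longrightarrow> a - a' \<in> M" if "a \<in> M" for r a a'
      using that by (auto simp: M_def span_scale span_diff)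
    have "g * b \<in> M \<and> x * b \<in> M"
      using b unfolding list.set by (elim insertE emptyE; simp add: normal_form mem closed)
    then show "case_gx g x l * b \<in> span (set B)" by (cases l) (auto simp: M_def)
  qed (simp add: span_base)
  ultimately show ?thesis by (rule is_basis_of_coordinates8[OF T(1)])
qed

end

locale cyclic4_hopf = hopf_algebra scale \<Delta> \<epsilon> S + cyclic4 scale g x c t
  for scale :: "'k::field \<Rightarrow> 'a::ring_1 \<Rightarrow> 'a" and \<Delta> \<epsilon> S g x c t +
  fixes s :: 'a
  assumes basis: "is_basis scale B" and g: "group_like scale \<Delta> g"
    and s: "s \<in> {g, g ^ 2}" and x: "skew_primitive scale \<Delta> s x"
begin

sublocale rank_one_hopf scale \<Delta> \<epsilon> S B "{1, g, g ^ 2, g ^ 3}" s x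
proof
  have dist: "distinct B" and indep: "independent (set B)"
    using basis by (auto simp: is_basis_def)
  show "is_basis scale B" by (rule basis)
  show "is_skew scale \<Delta> 1 s x" by (rule is_skew_skew_primitive[OF x])
  show "{1, g, g ^ 2, g ^ 3} \<inter> (\<lambda>u. u * x) ` {1, g, g ^ 2, g ^ 3} = {}"
    using dist by auto
  have "g * g \<noteq> 0" "g * (g * g) \<noteq> 0"
    using dependent_zero[of "set B"] indep by (auto simp: power2_eq_square power3_eq_cube mult.assoc)
  then have "group_like scale \<Delta> (g * g)" "group_like scale \<Delta> (g * (g * g))"
    by (auto intro: group_like_mult g)
  then show "group_like scale \<Delta> u" if "u \<in> {1, g, g ^ 2, g ^ 3}" for u
    using that g group_like_one by (auto simp: power2_eq_square power3_eq_cube mult.assoc)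
qed (use s in \<open>auto simp: normal_form\<close>)

lemma has_values_counit: "has_values scale B \<epsilon> [1, 1, 1, 1, 0, 0, 0, 0]"
  using counit_G counit_G_x[of 1] counit_G_x[of g] counit_G_x[of "g ^ 2"] counit_G_x[of "g ^ 3"]
  by (simp add: has_values_def counit_linear)

lemma partial_action_eqs:
  assumes "partial_action scale \<Delta> lam"
  shows "lam 1 = 1" "u \<in> {g, g ^ 2, g ^ 3} \<Longrightarrow> lam u \<noteq> 0 \<Longrightarrow> lam (u * k) = lam k"
    "u \<in> {1, g, g ^ 2, g ^ 3} \<Longrightarrow>
      lam (u * x) * lam k = lam (u * x) * lam (u * k) + lam (u * s) * lam (u * x * k)"
proof -
  show "lam 1 = 1" using assms by (simp add: partial_action_def)
  show "lam (u * k) = lam k" if "u \<in> {g, g ^ 2, g ^ 3}" "lam u \<noteq> 0"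
    using partial_action_group_like[OF assms, of u k] group_like[of u] that by auto
  show "lam (u * x) * lam k = lam (u * x) * lam (u * k) + lam (u * s) * lam (u * x * k)"
    if "u \<in> {1, g, g ^ 2, g ^ 3}"
    by (rule partial_action_skew[OF assms is_skew_mult_x[OF that]])
qed

text \<open>If \<open>\<lambda>(g) \<noteq> 0\<close>, the map is invariant under the whole group of group-likes. Then \<open>\<lambda>(s) = 1\<close>, and the
  equation for \<open>x\<close> at \<open>k = 1\<close> gives \<open>\<lambda>(x) = 2 \<lambda>(x)\<close>.\<close>

lemma partial_action_eq_counit:
  assumes "partial_action scale \<Delta> lam" "lam g \<noteq> 0"
  shows "lam = \<epsilon>"
proof (rule has_values_unique[OF basis _ has_values_counit])
  note eqs = partial_action_eqs[OF assms(1)]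
  have lin: "Vector_Spaces.linear scale (*) lam"
    using assms(1) by (simp add: partial_action_def)
  have g_k: "lam (g * k) = lam k" for k
    using eqs(2)[of g] assms(2) by simp
  have one: "lam g = 1" using g_k[of 1] eqs(1) by simp
  have "lam s = 1"
    using s g_k[of g] by (auto simp: one power2_eq_square)
  then have "lam x = 0" using eqs(3)[of 1 1] eqs(1) by (simp add: two_neq_one)
  then show "has_values scale B lam [1, 1, 1, 1, 0, 0, 0, 0]"
    using lin one eqs(1)
    by (simp add: has_values_def power2_eq_square power3_eq_cube mult.assoc g_k)
qed

text \<open>The case \<open>s = g\<close>, which covers \<open>\<A>\<^sub>4'\<close> with \<open>t = 0\<close> and \<open>\<A>\<^sub>4''\<close> with \<open>t = 1\<close>. Let
  \<open>\<lambda>(g) = 0\<close>. The one quadratic condition on the parameter arises when \<open>\<lambda>(g\<^sup>2) = 0\<close>: the equation for \<open>g\<^sup>3 x\<close>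
  at \<open>k = g x\<close> contains \<open>\<lambda>(g\<^sup>3 x g x) = - t \<lambda>(g\<^sup>2 - 1) = t\<close> and reads
  \<open>0 = \<lambda>(g\<^sup>3 x) \<lambda>(x) + t\<close>, where \<open>\<lambda>(g\<^sup>3 x) = \<lambda>(x)\<close>.\<close>

lemma partial_actions_s_g:
  assumes s: "s = g" and c: "c = -1"
  shows "partial_action scale \<Delta> lam \<longleftrightarrow> lam = \<epsilon> \<or>
     (\<exists>\<alpha>. has_values scale B lam [1, 0, 1, 0, \<alpha>, \<alpha>, \<alpha>, \<alpha>]) \<or>
     (\<exists>\<gamma>. \<gamma> ^ 2 = - t \<and> has_values scale B lam [1, 0, 0, 0, \<gamma>, 0, 0, \<gamma>])"
    (is "_ \<longleftrightarrow> _ \<or> ?two \<or> ?one")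
proof
  assume P: "partial_action scale \<Delta> lam"
  note eqs = partial_action_eqs[OF P]
  have lin: "Vector_Spaces.linear scale (*) lam"
    using P by (simp add: partial_action_def)
  interpret lam: Vector_Spaces.linear scale "(*)" lam by (rule lin)
  note simps = normal_form c s eqs(1) lam.scale lam.diff lam.neg
  show "lam = \<epsilon> \<or> ?two \<or> ?one"
  proof (cases "lam g = 0")
    case g: True
    show ?thesis
    proof (cases "lam (g ^ 2) = 0")
      case False
      have g2: "lam (g * (g * k)) = lam k" for k
        using eqs(2)[of "g ^ 2" k] False by (simp add: power2_eq_square mult.assoc)
      have "lam (g * g) = 1" using g2[of 1] by (simp add: eqs(1))
      \<comment> \<open>the equation for \<open>g x\<close> at \<open>k = g\<close>, where \<open>g x g = - g\<^sup>2 x\<close> and \<open>\<lambda>\<close> is invariant under \<open>g\<^sup>2\<close>\<close>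
      moreover have "lam (g * x) = lam x"
        using eqs(3)[of g g] g g2[of 1] g2[of x] by (simp add: simps)
      ultimately have "has_values scale B lam [1, 0, 1, 0, lam x, lam x, lam x, lam x]"
        using lin g g2 by (simp add: has_values_def simps)
      then show ?thesis by blast
    next
      case g2: True
      \<comment> \<open>\<open>\<lambda>(g\<^sup>3) \<noteq> 0\<close> would make \<open>\<lambda>\<close> invariant under \<open>g\<^sup>3\<close>, hence \<open>\<lambda>(g) = \<lambda>(g\<^sup>4) = 1\<close>\<close>
      have g3: "lam (g ^ 3) = 0"
        using eqs(2)[of "g ^ 3" g] g by (auto simp: simps)
      have "lam (g * x) = 0" using eqs(3)[of g 1] g g2 by (simp add: simps)
      moreover have "lam (g ^ 2 * x) = 0"
        using eqs(3)[of "g ^ 2" 1] g3 g2 by (simp add: simps)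
      moreover have x: "lam (g ^ 3 * x) = lam x"
        using eqs(3)[of "g ^ 3" g] g by (simp add: simps)
      moreover have "lam x ^ 2 = - t"
        using eqs(3)[of "g ^ 3" "g * x"] g2 x \<open>lam (g * x) = 0\<close>
        by (simp add: simps power2_eq_square eq_neg_iff_add_eq_0)
      ultimately have "has_values scale B lam [1, 0, 0, 0, lam x, 0, 0, lam x]"
        using lin g g2 g3 by (simp add: has_values_def eqs(1))
      then show ?thesis using \<open>lam x ^ 2 = - t\<close> by blast
    qed
  qed (use partial_action_eq_counit[OF P] in blast)
next
  have "partial_action scale \<Delta> lam"
    if v: "has_values scale B lam [1, 0, 1, 0, \<alpha>, \<alpha>, \<alpha>, \<alpha>]" for \<alpha>
  proof -
    interpret lam: Vector_Spaces.linear scale "(*)" lam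
      using v by (simp add: has_values_def)
    show ?thesis
      using v unfolding partial_action_iff
      by (simp add: has_values_def normal_form c s lam.scale lam.diff lam.neg)
  qed
  moreover have "partial_action scale \<Delta> lam"
    if \<gamma>: "\<gamma> ^ 2 = - t" and v: "has_values scale B lam [1, 0, 0, 0, \<gamma>, 0, 0, \<gamma>]" for \<gamma>
  proof -
    interpret lam: Vector_Spaces.linear scale "(*)" lam
      using v by (simp add: has_values_def)
    show ?thesis
      using v \<gamma> unfolding partial_action_iff
      by (simp add: has_values_def normal_form c s lam.scale lam.diff lam.neg power2_eq_square)
  qed
  ultimately show "partial_action scale \<Delta> lam" if "lam = \<epsilon> \<or> ?two \<or> ?one"
    using that partial_action_counit by blast
qed

text \<open>The case \<open>s = g\<^sup>2\<close> of \<open>\<A>\<^sub>4'''\<close>. The roles of the two subgroups are exchanged: if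
  \<open>\<lambda>(g\<^sup>2) = 1\<close>, the equation for \<open>x\<close> forces \<open>\<lambda>(x k) = 0\<close> for all \<open>k\<close>; if \<open>\<lambda>(g\<^sup>2) = 0\<close>, it is empty, and
  \<open>g\<^sup>2 x\<close> with \<open>g\<^sup>2 s = 1\<close> gives the relation \<open>\<lambda>(g\<^sup>2 x) = - c\<^sup>2 \<lambda>(x) = \<lambda>(x)\<close>.\<close>

lemma partial_actions_s_g2:
  assumes s: "s = g ^ 2" and c: "c ^ 2 = -1" and t: "t = 0"
  shows "partial_action scale \<Delta> lam \<longleftrightarrow> lam = \<epsilon> \<or>
     (\<exists>\<alpha>. has_values scale B lam [1, 0, 0, 0, \<alpha>, 0, \<alpha>, 0]) \<or>
     has_values scale B lam [1, 0, 1, 0, 0, 0, 0, 0]"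
    (is "_ \<longleftrightarrow> _ \<or> ?one \<or> ?two")
proof
  assume P: "partial_action scale \<Delta> lam"
  note eqs = partial_action_eqs[OF P]
  have lin: "Vector_Spaces.linear scale (*) lam"
    using P by (simp add: partial_action_def)
  interpret lam: Vector_Spaces.linear scale "(*)" lam by (rule lin)
  have "c \<noteq> 0" using c by auto
  have cc: "c * c = -1" "c * (c * r) = - r" for r
    using c by (simp_all add: power2_eq_square flip: mult.assoc)
  note simps = normal_form s eqs(1) lam.scale lam.diff lam.neg cc t
  show "lam = \<epsilon> \<or> ?one \<or> ?two"
  proof (cases "lam g = 0")
    case g: True
    show ?thesis
    proof (cases "lam (g ^ 2) = 0")
      case False
      have g2: "lam (g * (g * k)) = lam k" for k
        using eqs(2)[of "g ^ 2" k] False by (simp add: power2_eq_square mult.assoc)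
      have g21: "lam (g * g) = 1" using g2[of 1] by (simp add: eqs(1))
      have "lam x = 0" "lam (g * x) = 0"
        using eqs(3)[of 1 1] eqs(3)[of 1 g] \<open>c \<noteq> 0\<close> g by (simp_all add: simps g21 two_neq_one)
      then have ?two
        using lin g g2 g21 by (simp add: has_values_def simps)
      then show ?thesis by blast
    next
      case g2: True
      have g3: "lam (g ^ 3) = 0"
        using eqs(2)[of "g ^ 3" g] g by (auto simp: simps)
      have "lam (g * x) = 0" using eqs(3)[of g 1] g g3 by (simp add: simps)
      moreover have "lam (g ^ 3 * x) = 0"
        using eqs(3)[of "g ^ 3" 1] g3 g by (simp add: simps)
      moreover have "lam (g ^ 2 * x) = lam x"
        using eqs(3)[of "g ^ 2" "g ^ 2"] g2 by (simp add: simps)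
      ultimately have "has_values scale B lam [1, 0, 0, 0, lam x, 0, lam x, 0]"
        using lin g g2 g3 by (simp add: has_values_def eqs(1))
      then show ?thesis by blast
    qed
  qed (use partial_action_eq_counit[OF P] in blast)
next
  have cc: "c * c = -1" "c * (c * r) = - r" for r
    using c by (simp_all add: power2_eq_square flip: mult.assoc)
  have "partial_action scale \<Delta> lam"
    if "v = [1, 0, 0, 0, \<alpha>, 0, \<alpha>, 0] \<or> v = [1, 0, 1, 0, 0, 0, 0, 0]" and v: "has_values scale B lam v"
    for \<alpha> v
  proof -
    interpret lam: Vector_Spaces.linear scale "(*)" lam
      using v by (simp add: has_values_def)
    show ?thesis
      using that unfolding partial_action_iff
      by (elim disjE; simp add: has_values_def normal_form s lam.scale lam.diff lam.neg cc t)
  qed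
  then show "partial_action scale \<Delta> lam" if "lam = \<epsilon> \<or> ?one \<or> ?two"
    using that partial_action_counit by blast
qed

end

lemma (in hopf_algebra) cyclic4_hopf_of_presentation:
  assumes pres: "presents scale (case_gx g x) E"
    and "group_like scale \<Delta> g" "s \<in> {g, g ^ 2}" "skew_primitive scale \<Delta> s x"
    and "c ^ 4 = 1" "t * c ^ 2 = t"
    and "g ^ 4 = 1" "x * g = scale c (g * x)" "x * x = scale t (g ^ 2 - 1)"
    and "\<And>l r v. (l, r) \<in> E \<Longrightarrow>
      act scale8 (case_gx cyc_g (cyc_x c t)) l v = act scale8 (case_gx cyc_g (cyc_x c t)) r v"
  shows "cyclic4_hopf scale \<Delta> \<epsilon> S g x c t s"
proof -
  interpret cyclic4 scale g x c t by unfold_locales (use assms in auto)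
  show ?thesis
    using basis_of_presentation[OF pres] assms
    by unfold_locales auto
qed

text \<open>For \<open>t = 0\<close> the last family collapses to \<open>\<gamma> = 0\<close>.\<close>

lemma (in hopf_algebra) A4'_A4''_partial_actions:
  assumes "t = 0 \<and> is_A4' scale \<Delta> g x \<or> t = 1 \<and> is_A4'' scale \<Delta> g x"
  defines "B \<equiv> [1, g, g ^ 2, g ^ 3, x, g * x, g ^ 2 * x, g ^ 3 * x]"
  shows "is_basis scale B \<and> has_values scale B \<epsilon> [1, 1, 1, 1, 0, 0, 0, 0] \<and>
    {lam. partial_action scale \<Delta> lam} = {\<epsilon>} \<union>
      {lam. \<exists>\<alpha>. has_values scale B lam [1, 0, 1, 0, \<alpha>, \<alpha>, \<alpha>, \<alpha>]} \<union>
      {lam. \<exists>\<gamma>. \<gamma> ^ 2 = - t \<and> has_values scale B lam [1, 0, 0, 0, \<gamma>, 0, 0, \<gamma>]} \<and>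
    (\<forall>lam \<alpha>. has_values scale B lam [1, 0, 1, 0, \<alpha>, \<alpha>, \<alpha>, \<alpha>] \<longrightarrow>
       unit_locus scale \<Delta> lam = {1, g ^ 2}) \<and>
    (\<forall>lam \<gamma>. \<gamma> ^ 2 = - t \<and> has_values scale B lam [1, 0, 0, 0, \<gamma>, 0, 0, \<gamma>] \<longrightarrow>
       unit_locus scale \<Delta> lam = {1})"
proof -
  define E :: "((gx word \<Rightarrow>\<^sub>0 'k) \<times> (gx word \<Rightarrow>\<^sub>0 'k)) set" where
    "E = {(gen Gx_g ^ 4, 1), (gen Gx_x ^ 2, const t * (gen Gx_g ^ 2 - 1)),
      (gen Gx_x * gen Gx_g, - (gen Gx_g * gen Gx_x))}"
  have const: "const 0 = (0 :: gx word \<Rightarrow>\<^sub>0 'k)" "const 1 = (1 :: gx word \<Rightarrow>\<^sub>0 'k)"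
    by (simp_all add: const_def)
  have E: "presents scale (case_gx g x) E" "group_like scale \<Delta> g" "skew_primitive scale \<Delta> g x"
    using assms(1) unfolding is_A4'_def is_A4''_def rels_A4'_def rels_A4''_def Let_def E_def
    by (auto simp: const)
  interpret act: free_algebra_module scale8 "case_gx cyc_g (cyc_x (-1) t)" by (rule cyc_module)
  have rel: "g ^ 4 = 1" "x * x = scale t (g ^ 2 - 1)" "x * g = scale (-1) (g * x)"
    using presents_relations[OF E(1)] unfolding E_def
    by (simp_all add: eval_free_simps scale_times power2_eq_square)
  interpret cyclic4_hopf scale \<Delta> \<epsilon> S g x "-1" t g
  proof (rule cyclic4_hopf_of_presentation[OF E(1)])
    fix l r v assume "(l, r) \<in> E"
    then show "act scale8 (case_gx cyc_g (cyc_x (-1) t)) l v =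
        act scale8 (case_gx cyc_g (cyc_x (-1) t)) r v"
      unfolding E_def
      by (cases v rule: vec8_cases)
        (auto simp: power4_eq_xxxx power2_eq_square act.act_mult act.act_gen act.act_1 act.act_const
          act.act_diff act.act_uminus right_diff_distrib power3_eq_cube)
  qed (use E rel in auto)
  have dist: "distinct B"
    using basis by (simp add: is_basis_def B_def)
  show ?thesis
    using basis has_values_counit partial_actions_s_g dist
    unfolding B_def unit_locus_eq by (auto simp: has_values_def)
qed

text \<open>A primitive fourth root of unity has \<open>q\<^sup>2 = -1\<close>, so that \<open>g x = q x g\<close> becomes \<open>x g = - q g x\<close>.\<close>

lemma (in hopf_algebra) A4q_partial_actions:
  assumes q: "primitive_root_of_unity 4 q" and A: "is_A4''' scale \<Delta> q g x"
  defines "B \<equiv> [1, g, g ^ 2, g ^ 3, x, g * x, g ^ 2 * x, g ^ 3 * x]"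
  shows "is_basis scale B \<and> has_values scale B \<epsilon> [1, 1, 1, 1, 0, 0, 0, 0] \<and>
    {lam. partial_action scale \<Delta> lam} = {\<epsilon>} \<union>
      {lam. \<exists>\<alpha>. has_values scale B lam [1, 0, 0, 0, \<alpha>, 0, \<alpha>, 0]} \<union>
      {lam. has_values scale B lam [1, 0, 1, 0, 0, 0, 0, 0]} \<and>
    (\<forall>lam \<alpha>. has_values scale B lam [1, 0, 0, 0, \<alpha>, 0, \<alpha>, 0] \<longrightarrow> unit_locus scale \<Delta> lam = {1}) \<and>
    (\<forall>lam. has_values scale B lam [1, 0, 1, 0, 0, 0, 0, 0] \<longrightarrow>
       unit_locus scale \<Delta> lam = {1, g ^ 2})"
proof -
  have E: "presents scale (case_gx g x) (rels_A4''' q)" "group_like scale \<Delta> g"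
    "skew_primitive scale \<Delta> (g ^ 2) x"
    using A by (auto simp: is_A4'''_def)
  have "(q ^ 2 - 1) * (q ^ 2 + 1) = 0"
    using q by (simp add: primitive_root_of_unity_def algebra_simps flip: power_add)
  moreover have "q ^ 2 \<noteq> 1"
    using q by (simp add: primitive_root_of_unity_def)
  ultimately have q2: "q ^ 2 = -1"
    by (simp add: eq_neg_iff_add_eq_0)
  then have qq: "q * q = -1" "q * (q * r) = - r" for r
    by (simp_all add: power2_eq_square flip: mult.assoc)
  interpret act: free_algebra_module scale8 "case_gx cyc_g (cyc_x (- q) 0)" by (rule cyc_module)
  have rel: "g ^ 4 = 1" "x * x = 0" "g * x = scale q (x * g)"
    using presents_relations[OF E(1)] unfolding rels_A4'''_def Let_def
    by (simp_all add: eval_free_simps scale_times power2_eq_square)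
  interpret cyclic4_hopf scale \<Delta> \<epsilon> S g x "- q" 0 "g ^ 2"
  proof (rule cyclic4_hopf_of_presentation[OF E(1)])
    fix l r v assume "(l, r) \<in> rels_A4''' q"
    then show "act scale8 (case_gx cyc_g (cyc_x (- q) 0)) l v =
        act scale8 (case_gx cyc_g (cyc_x (- q) 0)) r v"
      unfolding rels_A4'''_def Let_def
      by (cases v rule: vec8_cases)
        (auto simp: power4_eq_xxxx power2_eq_square power3_eq_cube act.act_mult act.act_gen
          act.act_1 act.act_const act.act_0 zero_prod_def qq)
  qed (use E rel q in \<open>auto simp: qq primitive_root_of_unity_def\<close>)
  have dist: "distinct B"
    using basis by (simp add: is_basis_def B_def)
  show ?thesis
    using basis has_values_counit partial_actions_s_g2 dist q2
    unfolding B_def unit_locus_eq by (auto simp: has_values_def)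
qed

section \<open>The group-likes form a Klein four-group\<close>

text \<open>The left regular representation in the basis \<open>1, g, h, g h, x, g x, h x, g h x\<close>.\<close>

fun klein_act :: "ghx \<Rightarrow> 'k::field vec8 \<Rightarrow> 'k vec8" where
  "klein_act Ghx_g (a0, a1, a2, a3, b0, b1, b2, b3) = (a1, a0, a3, a2, b1, b0, b3, b2)"
| "klein_act Ghx_h (a0, a1, a2, a3, b0, b1, b2, b3) = (a2, a3, a0, a1, b2, b3, b0, b1)"
| "klein_act Ghx_x (a0, a1, a2, a3, b0, b1, b2, b3) = (0, 0, 0, 0, a0, - a1, - a2, a3)"

lemma klein_module: "free_algebra_module scale8 klein_act"
proof
  fix l r v w
  show "klein_act l (v + w) = klein_act l v + klein_act l w"
    by (cases l; cases v rule: vec8_cases; cases w rule: vec8_cases) simp_all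
  show "klein_act l (scale8 r v) = scale8 r (klein_act l v)"
    by (cases l; cases v rule: vec8_cases) simp_all
qed

text \<open>The case distinction follows the subgroup on which \<open>\<lambda>\<close> is \<open>1\<close>. Since \<open>s = g\<close>, the relation
  \<open>\<lambda>(g x) = \<lambda>(x)\<close> holds whenever \<open>\<lambda>(g) = 0\<close>. For the subgroup \<open>{1, h}\<close> the equation for \<open>g h x\<close> at \<open>k = h\<close>
  gives \<open>2 \<lambda>(g x) = 0\<close>, because \<open>x\<close> anticommutes with \<open>h\<close>; for \<open>{1, g h}\<close> it commutes with \<open>g h\<close>, and
  the parameter survives.\<close>

lemma (in hopf_algebra) A22_partial_actions:
  fixes g h x :: 'a
  assumes A: "is_A22 scale \<Delta> g h x" and char: "(2 :: 'k) \<noteq> 0"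
  defines "B \<equiv> [1, g, h, g * h, x, g * x, h * x, g * h * x]"
  shows "is_basis scale B \<and> has_values scale B \<epsilon> [1, 1, 1, 1, 0, 0, 0, 0] \<and>
    {lam. partial_action scale \<Delta> lam} = {\<epsilon>} \<union>
      {lam. \<exists>\<alpha>. has_values scale B lam [1, 0, 0, 0, \<alpha>, \<alpha>, 0, 0]} \<union>
      {lam. \<exists>\<alpha>. has_values scale B lam [1, 0, 0, 1, \<alpha>, \<alpha>, \<alpha>, \<alpha>]} \<union>
      {lam. has_values scale B lam [1, 0, 1, 0, 0, 0, 0, 0]} \<union>
      {lam. has_values scale B lam [1, 1, 0, 0, 0, 0, 0, 0]} \<and>
    (\<forall>lam \<alpha>. has_values scale B lam [1, 0, 0, 0, \<alpha>, \<alpha>, 0, 0] \<longrightarrow> unit_locus scale \<Delta> lam = {1}) \<and>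
    (\<forall>lam \<alpha>. has_values scale B lam [1, 0, 0, 1, \<alpha>, \<alpha>, \<alpha>, \<alpha>] \<longrightarrow>
       unit_locus scale \<Delta> lam = {1, g * h}) \<and>
    (\<forall>lam. has_values scale B lam [1, 0, 1, 0, 0, 0, 0, 0] \<longrightarrow> unit_locus scale \<Delta> lam = {1, h}) \<and>
    (\<forall>lam. has_values scale B lam [1, 1, 0, 0, 0, 0, 0, 0] \<longrightarrow> unit_locus scale \<Delta> lam = {1, g})"
proof -
  have E: "presents scale (case_ghx g h x) rels_A22" "group_like scale \<Delta> g" "group_like scale \<Delta> h"
    "skew_primitive scale \<Delta> g x"
    using A by (auto simp: is_A22_def)
  interpret act: free_algebra_module scale8 klein_act by (rule klein_module)
  have act_rel: "act scale8 klein_act l v = act scale8 klein_act r v"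
    if "(l, r) \<in> rels_A22" for l r v
    using that unfolding rels_A22_def Let_def
    by (cases v rule: vec8_cases)
      (auto simp: power2_eq_square act.act_mult act.act_gen act.act_1 act.act_uminus act.act_0
        zero_prod_def)
  have rel: "g * g = 1" "h * h = 1" "x * x = 0" "x * g = - (g * x)" "x * h = - (h * x)"
    "h * g = g * h"
    using presents_relations[OF E(1)] unfolding rels_A22_def Let_def
    by (simp_all add: eval_free_simps power2_eq_square)
  have rel_mult: "g * (g * a) = a" "h * (h * a) = a" "x * (x * a) = 0" "x * (g * a) = - (g * (x * a))"
    "x * (h * a) = - (h * (x * a))" "h * (g * a) = g * (h * a)" for a
    by (simp_all add: rel flip: mult.assoc)
  note normal_form = mult.assoc rel rel_mult
  obtain T where T: "Vector_Spaces.linear scale scale8 T" "T 1 = (1,0,0,0,0,0,0,0)"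
    and T_mult: "\<And>l a. T (case_ghx g h x l * a) = klein_act l (T a)"
    using presents_module_map[OF E(1) klein_module act_rel] by blast
  have Ts: "T (g * a) = klein_act Ghx_g (T a)" "T (h * a) = klein_act Ghx_h (T a)"
    "T (x * a) = klein_act Ghx_x (T a)" for a
    using T_mult[of Ghx_g a] T_mult[of Ghx_h a] T_mult[of Ghx_x a] by simp_all
  have "map T B = unit8"
    using Ts[of 1] T(2) by (simp add: B_def unit8_def mult.assoc Ts)
  moreover have "span (set B) = UNIV"
  proof (rule presents_span[OF E(1)])
    fix l b assume b: "b \<in> set B"
    define M where "M = span (set B)"
    have mem: "1 \<in> M" "g \<in> M" "h \<in> M" "g * h \<in> M" "x \<in> M" "g * x \<in> M" "h * x \<in> M"
      "g * (h * x) \<in> M"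
      unfolding M_def by (rule span_base, simp add: B_def mult.assoc)+
    have closed: "0 \<in> M" "\<And>a. a \<in> M \<Longrightarrow> - a \<in> M"
      by (auto simp: M_def span_neg span_zero)
    have "g * b \<in> M \<and> h * b \<in> M \<and> x * b \<in> M"
      using b unfolding list.set B_def
      by (elim insertE emptyE; simp add: normal_form mem closed)
    then show "case_ghx g h x l * b \<in> span (set B)" by (cases l) (auto simp: M_def)
  qed (simp add: span_base B_def)
  ultimately have basis: "is_basis scale B" by (rule is_basis_of_coordinates8[OF T(1)])
  have dist: "distinct B" and indep: "independent (set B)"
    using basis by (auto simp: is_basis_def)
  interpret rank_one_hopf scale \<Delta> \<epsilon> S B "{1, g, h, g * h}" g x
  proof
    show "is_basis scale B" by (rule basis)
    show "is_skew scale \<Delta> 1 g x" by (rule is_skew_skew_primitive[OF E(4)])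
    show "{1, g, h, g * h} \<inter> (\<lambda>u. u * x) ` {1, g, h, g * h} = {}"
      using dist by (auto simp: B_def)
    have "g * h \<noteq> 0"
      using dependent_zero[of "set B"] indep by (auto simp: B_def)
    then show "group_like scale \<Delta> u" if "u \<in> {1, g, h, g * h}" for u
      using that E group_like_one by (auto intro: group_like_mult)
  qed (auto simp: B_def normal_form)
  have eps: "has_values scale B \<epsilon> [1, 1, 1, 1, 0, 0, 0, 0]"
    using counit_G counit_G_x[of 1] counit_G_x[of g] counit_G_x[of h] counit_G_x[of "g * h"]
    by (simp add: has_values_def counit_linear B_def)
  have "partial_action scale \<Delta> lam \<longleftrightarrow> lam = \<epsilon> \<or>
      (\<exists>\<alpha>. has_values scale B lam [1, 0, 0, 0, \<alpha>, \<alpha>, 0, 0]) \<or>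
      (\<exists>\<alpha>. has_values scale B lam [1, 0, 0, 1, \<alpha>, \<alpha>, \<alpha>, \<alpha>]) \<or>
      has_values scale B lam [1, 0, 1, 0, 0, 0, 0, 0] \<or>
      has_values scale B lam [1, 1, 0, 0, 0, 0, 0, 0]"
    (is "_ \<longleftrightarrow> _ \<or> ?one \<or> ?gh \<or> ?h \<or> ?g") for lam
  proof
    assume P: "partial_action scale \<Delta> lam"
    have lin: "Vector_Spaces.linear scale (*) lam" and one: "lam 1 = 1"
      using P by (simp_all add: partial_action_def)
    interpret lam: Vector_Spaces.linear scale "(*)" lam by (rule lin)
    have inv: "lam (u * k) = lam k" if "u \<in> {g, h, g * h}" "lam u \<noteq> 0" for u k
      using partial_action_group_like[OF P, of u k] group_like[of u] that by auto
    have skew: "lam (u * x) * lam k = lam (u * x) * lam (u * k) + lam (u * g) * lam (u * x * k)"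
      if "u \<in> {1, g, h, g * h}" for u k
      by (rule partial_action_skew[OF P is_skew_mult_x[OF that]])
    note simps = normal_form one lam.neg
    have gx: "lam (g * x) = lam x" if "lam g = 0"
      using skew[of g g] that by (simp add: simps)
    show "lam = \<epsilon> \<or> ?one \<or> ?gh \<or> ?h \<or> ?g"
    proof (cases "lam g = 0")
      case False
      have g: "lam (g * k) = lam k" for k using inv[of g k] False by simp
      have g1: "lam g = 1" using g[of 1] one by simp
      have x: "lam x = 0" "lam (h * x) = 0"
        using skew[of 1 1] skew[of 1 h] g by (simp_all add: simps g1 two_neq_one)
      show ?thesis
      proof (cases "lam h = 0")
        case True
        then have ?g using lin x g g1 by (simp add: has_values_def B_def simps)
        then show ?thesis by blast
      next
        case False
        have "lam h = 1" using inv[of h 1] False one by simp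
        then have "has_values scale B lam [1, 1, 1, 1, 0, 0, 0, 0]"
          using lin x g g1 by (simp add: has_values_def B_def simps)
        then have "lam = \<epsilon>" by (rule has_values_unique[OF basis _ eps])
        then show ?thesis by blast
      qed
    next
      case g: True
      show ?thesis
      proof (cases "lam h = 0")
        case False
        have h: "lam (h * k) = lam k" for k using inv[of h k] False by simp
        have h1: "lam h = 1" using h[of 1] one by simp
        have gh: "lam (g * (h * k)) = lam (g * k)" for k
          using h[of "g * k"] by (simp add: simps)
        have "2 * lam (g * x) = 0"
          using skew[of "g * h" h] g h1 gh[of x] by (simp add: simps)
        then have "lam (g * x) = 0" using char by simp
        then have ?h
          using lin g h1 h gx[OF g] gh[of 1] gh[of x] by (simp add: has_values_def B_def simps)
        then show ?thesis by blast
      next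
        case h: True
        show ?thesis
        proof (cases "lam (g * h) = 0")
          case True
          have "lam (h * x) = 0" "lam (g * (h * x)) = 0"
            using skew[of h 1] skew[of "g * h" 1] g h True by (simp_all add: simps)
          then have "has_values scale B lam [1, 0, 0, 0, lam x, lam x, 0, 0]"
            using lin g h True gx[OF g] by (simp add: has_values_def B_def simps)
          then show ?thesis by blast
        next
          case False
          have gh: "lam (g * (h * k)) = lam k" for k
            using inv[of "g * h" k] False by (simp add: simps)
          have "lam (h * x) = lam (g * x)" using gh[of "h * x"] by (simp add: simps)
          then have "has_values scale B lam [1, 0, 0, 1, lam x, lam x, lam x, lam x]"
            using lin g h gx[OF g] gh[of 1] gh[of x] by (simp add: has_values_def B_def simps)
          then show ?thesis by blast
        qed
      qed
    qed
  next
    have "partial_action scale \<Delta> lam"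
      if "v = [1, 0, 0, 0, \<alpha>, \<alpha>, 0, 0] \<or> v = [1, 0, 0, 1, \<alpha>, \<alpha>, \<alpha>, \<alpha>] \<or>
          v = [1, 0, 1, 0, 0, 0, 0, 0] \<or> v = [1, 1, 0, 0, 0, 0, 0, 0]"
        and v: "has_values scale B lam v" for \<alpha> v
    proof -
      interpret lam: Vector_Spaces.linear scale "(*)" lam
        using v by (simp add: has_values_def)
      show ?thesis
        using that unfolding partial_action_iff
        by (elim disjE; simp add: has_values_def B_def normal_form lam.neg)
    qed
    then show "partial_action scale \<Delta> lam" if "lam = \<epsilon> \<or> ?one \<or> ?gh \<or> ?h \<or> ?g"
      using that partial_action_counit by blast
  qed
  then show ?thesis
    using basis eps dist unfolding unit_locus_eq by (auto simp: has_values_def B_def)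
qed

section \<open>Two skew-primitive generators\<close>

text \<open>The left regular representation in the basis \<open>1, g, x, y, g x, g y, x y, g x y\<close>; the elements
  \<open>x\<close> and \<open>y\<close> generate an exterior algebra.\<close>

fun exterior_act :: "gxy \<Rightarrow> 'k::field vec8 \<Rightarrow> 'k vec8" where
  "exterior_act Gxy_g (a, b, c, d, e, f, i, j) = (b, a, e, f, c, d, j, i)"
| "exterior_act Gxy_x (a, b, c, d, e, f, i, j) = (0, 0, a, 0, - b, 0, d, - f)"
| "exterior_act Gxy_y (a, b, c, d, e, f, i, j) = (0, 0, 0, a, 0, - b, - c, e)"

lemma exterior_module: "free_algebra_module scale8 exterior_act"
proof
  fix l r v w
  show "exterior_act l (v + w) = exterior_act l v + exterior_act l w"
    by (cases l; cases v rule: vec8_cases; cases w rule: vec8_cases) simp_all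
  show "exterior_act l (scale8 r v) = scale8 r (exterior_act l v)"
    by (cases l; cases v rule: vec8_cases) simp_all
qed

text \<open>The elements \<open>x y\<close> and \<open>g x y\<close> are not skew-primitive, and their comultiplication is computed from
  multiplicativity (\<open>coev_xy\<close>, \<open>coev_gxy\<close>). A partial action with \<open>\<lambda>(g) = 0\<close> vanishes on them: first
  \<open>\<lambda>(g x) = \<lambda>(x)\<close> and \<open>\<lambda>(g y) = \<lambda>(y)\<close>, and then the equations for \<open>g x\<close> at \<open>k = y\<close> and \<open>k = g y\<close> give
  \<open>\<lambda>(g x y) = 0\<close> and \<open>\<lambda>(x y) = 0\<close>.\<close>

lemma (in hopf_algebra) A2_partial_actions:
  fixes g x y :: 'a
  assumes A: "is_A2 scale \<Delta> g x y"
  defines "B \<equiv> [1, g, x, y, g * x, g * y, x * y, g * x * y]"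
  shows "is_basis scale B \<and> has_values scale B \<epsilon> [1, 1, 0, 0, 0, 0, 0, 0] \<and>
    {lam. partial_action scale \<Delta> lam} =
      {\<epsilon>} \<union> {lam. \<exists>\<alpha> \<beta>. has_values scale B lam [1, 0, \<alpha>, \<beta>, \<alpha>, \<beta>, 0, 0]} \<and>
    (\<forall>lam \<alpha> \<beta>. has_values scale B lam [1, 0, \<alpha>, \<beta>, \<alpha>, \<beta>, 0, 0] \<longrightarrow> unit_locus scale \<Delta> lam = {1})"
proof -
  have E: "presents scale (case_gxy g x y) rels_A2" "group_like scale \<Delta> g"
    "skew_primitive scale \<Delta> g x" "skew_primitive scale \<Delta> g y"
    using A by (auto simp: is_A2_def)
  interpret act: free_algebra_module scale8 exterior_act by (rule exterior_module)
  have act_rel: "act scale8 exterior_act l v = act scale8 exterior_act r v"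
    if "(l, r) \<in> rels_A2" for l r v
    using that unfolding rels_A2_def Let_def
    by (cases v rule: vec8_cases)
      (auto simp: power2_eq_square act.act_mult act.act_gen act.act_1 act.act_uminus act.act_0
        zero_prod_def)
  have rel: "g * g = 1" "x * x = 0" "y * y = 0" "x * g = - (g * x)" "y * g = - (g * y)"
    "y * x = - (x * y)"
    using presents_relations[OF E(1)] unfolding rels_A2_def Let_def
    by (simp_all add: eval_free_simps power2_eq_square)
  have rel_mult: "g * (g * a) = a" "x * (x * a) = 0" "y * (y * a) = 0" "x * (g * a) = - (g * (x * a))"
    "y * (g * a) = - (g * (y * a))" "y * (x * a) = - (x * (y * a))" for a
    by (simp_all add: rel flip: mult.assoc)
  note normal_form = mult.assoc rel rel_mult
  obtain T where T: "Vector_Spaces.linear scale scale8 T" "T 1 = (1,0,0,0,0,0,0,0)"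
    and T_mult: "\<And>l a. T (case_gxy g x y l * a) = exterior_act l (T a)"
    using presents_module_map[OF E(1) exterior_module act_rel] by blast
  have Ts: "T (g * a) = exterior_act Gxy_g (T a)" "T (x * a) = exterior_act Gxy_x (T a)"
    "T (y * a) = exterior_act Gxy_y (T a)" for a
    using T_mult[of Gxy_g a] T_mult[of Gxy_x a] T_mult[of Gxy_y a] by simp_all
  have "map T B = unit8"
    using Ts[of 1] T(2) by (simp add: B_def unit8_def mult.assoc Ts)
  moreover have "span (set B) = UNIV"
  proof (rule presents_span[OF E(1)])
    fix l b assume b: "b \<in> set B"
    define M where "M = span (set B)"
    have mem: "1 \<in> M" "g \<in> M" "x \<in> M" "y \<in> M" "g * x \<in> M" "g * y \<in> M" "x * y \<in> M"
      "g * (x * y) \<in> M"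
      unfolding M_def by (rule span_base, simp add: B_def mult.assoc)+
    have closed: "0 \<in> M" "\<And>a. a \<in> M \<Longrightarrow> - a \<in> M"
      by (auto simp: M_def span_neg span_zero)
    have "g * b \<in> M \<and> x * b \<in> M \<and> y * b \<in> M"
      using b unfolding list.set B_def
      by (elim insertE emptyE; simp add: normal_form mem closed)
    then show "case_gxy g x y l * b \<in> span (set B)" by (cases l) (auto simp: M_def)
  qed (simp add: span_base B_def)
  ultimately have basis: "is_basis scale B" by (rule is_basis_of_coordinates8[OF T(1)])
  have dist: "distinct B"
    using basis by (auto simp: is_basis_def)
  have skew_x: "is_skew scale \<Delta> 1 g x" and skew_y: "is_skew scale \<Delta> 1 g y"
    using E(3,4) is_skew_skew_primitive by auto
  have skew_gx: "is_skew scale \<Delta> g 1 (g * x)" and skew_gy: "is_skew scale \<Delta> g 1 (g * y)"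
    using is_skew_mult_left[OF E(2) skew_x] is_skew_mult_left[OF E(2) skew_y] by (simp_all add: rel)
  have neg: "F (- a) b = - F a b" if "bilinear_form scale F" for F :: "'a \<Rightarrow> 'a \<Rightarrow> 'k" and a b
    using that unfolding bilinear_form_def by (metis mult_minus1 scale_minus_left scale_one)
  have coev_xy: "coev \<Delta> F (x * y) = F (x * y) 1 - F (g * x) y + F (g * y) x + F 1 (x * y)"
    if F: "bilinear_form scale F" for F
  proof -
    let ?H = "\<lambda>p q. coev \<Delta> (\<lambda>r s. F (p * r) (q * s)) y"
    have "coev \<Delta> F (x * y) = ?H x 1 + ?H g x"
      using skew_x bilinear_form_coev_translate[OF F] by (simp add: coev_mult[OF F] is_skew_def)
    moreover have "?H p q = F (p * y) q + F (p * g) (q * y)" for p q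
      using skew_y bilinear_form_translate[OF F] by (simp add: is_skew_def)
    ultimately have "coev \<Delta> F (x * y) =
        (F (x * y) 1 + F (x * g) (1 * y)) + (F (g * y) x + F (g * g) (x * y))"
      by (simp only:)
    then show ?thesis by (simp add: rel neg[OF F])
  qed
  have coev_gxy: "coev \<Delta> F (g * (x * y)) =
      F (g * (x * y)) g - F x (g * y) + F y (g * x) + F g (g * (x * y))"
    if F: "bilinear_form scale F" for F
    using coev_xy[OF bilinear_form_translate[OF F, of g g]]
      coev_group_like[OF E(2) bilinear_form_coev_translate[OF F]]
    by (simp add: coev_mult[OF F, of g] rel_mult)
  have group_like_iff: "group_like scale \<Delta> u \<longleftrightarrow> u \<in> {1, g}" for u
  proof (rule group_like_iff_in_basis[OF basis])
    fix b assume b: "b \<in> set B - {1, g}"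
    have xy: "off_diagonal (set B) {1, g} (x * y)"
      unfolding off_diagonal_def
      by (rule exI[of _ "[(1, x * y, 1), (-1, g * x, y), (1, g * y, x), (1, 1, x * y)]"])
        (use dist in \<open>auto simp: coev_xy B_def\<close>)
    have gxy: "off_diagonal (set B) {1, g} (g * (x * y))"
      unfolding off_diagonal_def
      by (rule exI[of _ "[(1, g * (x * y), g), (-1, x, g * y), (1, y, g * x), (1, g, g * (x * y))]"])
        (use dist in \<open>auto simp: coev_gxy B_def mult.assoc\<close>)
    show "off_diagonal (set B) {1, g} b"
      using b off_diagonal_skew[OF skew_x, of "{1, g}" "set B"]
        off_diagonal_skew[OF skew_y, of "{1, g}" "set B"]
        off_diagonal_skew[OF skew_gx, of "{1, g}" "set B"]
        off_diagonal_skew[OF skew_gy, of "{1, g}" "set B"] xy gxy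
      by (auto simp: B_def mult.assoc)
  qed (use E group_like_one in \<open>auto simp: B_def\<close>)
  have eps: "has_values scale B \<epsilon> [1, 1, 0, 0, 0, 0, 0, 0]"
    using counit_skew[OF skew_x group_like_one E(2)] counit_skew[OF skew_y group_like_one E(2)]
    by (simp add: has_values_def counit_linear B_def counit_mult counit_one
        counit_group_like[OF E(2)])
  have "partial_action scale \<Delta> lam \<longleftrightarrow> lam = \<epsilon> \<or>
      (\<exists>\<alpha> \<beta>. has_values scale B lam [1, 0, \<alpha>, \<beta>, \<alpha>, \<beta>, 0, 0])" (is "_ \<longleftrightarrow> _ \<or> ?one") for lam
  proof
    assume P: "partial_action scale \<Delta> lam"
    have lin: "Vector_Spaces.linear scale (*) lam" and one: "lam 1 = 1"
      using P by (simp_all add: partial_action_def)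
    interpret lam: Vector_Spaces.linear scale "(*)" lam by (rule lin)
    note simps = normal_form one lam.neg
    show "lam = \<epsilon> \<or> ?one"
    proof (cases "lam g = 0")
      case False
      have g: "lam (g * k) = lam k" for k
        using partial_action_group_like[OF P E(2), of k] False by simp
      have g1: "lam g = 1" using g[of 1] one by simp
      have "lam (x * k) = 0" "lam (y * k) = 0" for k
        using partial_action_skew[OF P skew_x, of k] partial_action_skew[OF P skew_y, of k]
        by (simp_all add: g1 g)
      from this[of 1] this[of y] have "has_values scale B lam [1, 1, 0, 0, 0, 0, 0, 0]"
        using lin g g1 one by (simp add: has_values_def B_def mult.assoc)
      then show ?thesis using has_values_unique[OF basis _ eps] by blast
    next
      case True
      have gx: "lam (g * x) = lam x" and gy: "lam (g * y) = lam y"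
        using partial_action_skew[OF P skew_gx, of g] partial_action_skew[OF P skew_gy, of g] True
        by (simp_all add: simps)
      have "lam (g * (x * y)) = 0" "lam (x * y) = 0"
        using partial_action_skew[OF P skew_gx, of y] partial_action_skew[OF P skew_gx, of "g * y"]
        by (simp_all add: simps gx gy)
      then have "has_values scale B lam [1, 0, lam x, lam y, lam x, lam y, 0, 0]"
        using lin one True gx gy by (simp add: has_values_def B_def mult.assoc)
      then show ?thesis by blast
    qed
  next
    have "partial_action scale \<Delta> lam"
      if v: "has_values scale B lam [1, 0, \<alpha>, \<beta>, \<alpha>, \<beta>, 0, 0]" for \<alpha> \<beta>
    proof -
      have lin: "Vector_Spaces.linear scale (*) lam"
        using v by (simp add: has_values_def)
      interpret lam: Vector_Spaces.linear scale "(*)" lam by (rule lin)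
      have vals: "lam 1 = 1" "lam g = 0" "lam x = \<alpha>" "lam y = \<beta>" "lam (g * x) = \<alpha>"
        "lam (g * y) = \<beta>" "lam (x * y) = 0" "lam (g * (x * y)) = 0"
        using v by (simp_all add: has_values_def B_def mult.assoc)
      show ?thesis
      proof (rule partial_action_basisI[OF basis lin])
        fix h k assume h: "h \<in> set B" and k: "k \<in> set B"
        let ?F = "\<lambda>a b. lam a * lam (b * k)"
        have F: "bilinear_form scale ?F" by (rule bilinear_form_tensor_right[OF lin lin])
        note coevs = coev_group_like[OF group_like_one F] coev_group_like[OF E(2) F]
          is_skew_coev[OF skew_x F] is_skew_coev[OF skew_y F] is_skew_coev[OF skew_gx F]
          is_skew_coev[OF skew_gy F] coev_xy[OF F] coev_gxy[OF F]
        define K where "K = {1, g, x, y, g * x, g * y, x * y, g * (x * y)}"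
        have K: "set B = K" by (simp add: B_def K_def mult.assoc)
        have eqs:
          "\<forall>k\<in>K. lam 1 * lam k = lam 1 * lam (1 * k)"
          "\<forall>k\<in>K. lam g * lam k = lam g * lam (g * k)"
          "\<forall>k\<in>K. lam x * lam k = lam x * lam (1 * k) + lam g * lam (x * k)"
          "\<forall>k\<in>K. lam y * lam k = lam y * lam (1 * k) + lam g * lam (y * k)"
          "\<forall>k\<in>K. lam (g * x) * lam k = lam (g * x) * lam (g * k) + lam 1 * lam (g * x * k)"
          "\<forall>k\<in>K. lam (g * y) * lam k = lam (g * y) * lam (g * k) + lam 1 * lam (g * y * k)"
          "\<forall>k\<in>K. lam (x * y) * lam k = lam (x * y) * lam (1 * k) - lam (g * x) * lam (y * k) +
            lam (g * y) * lam (x * k) + lam 1 * lam (x * y * k)"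
          "\<forall>k\<in>K. lam (g * (x * y)) * lam k = lam (g * (x * y)) * lam (g * k) -
            lam x * lam (g * y * k) + lam y * lam (g * x * k) + lam g * lam (g * (x * y) * k)"
          unfolding K_def by (simp_all add: normal_form vals lam.neg mult.commute[of \<beta> \<alpha>])
        have "h \<in> {1, g, x, y, g * x, g * y, x * y, g * (x * y)}"
          using h by (simp add: K K_def)
        then show "lam h * lam k = coev \<Delta> ?F h"
          using eqs[THEN bspec, OF k[unfolded K]]
          by (elim insertE emptyE; simp only: coevs)
      qed (rule vals)
    qed
    then show "partial_action scale \<Delta> lam" if "lam = \<epsilon> \<or> ?one"
      using that partial_action_counit by blast
  qed
  then show ?thesis
    using basis eps unfolding unit_locus_def group_like_iff by (auto simp: has_values_def B_def)
qed

theorem proposition3p7: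
  fixes scale :: "'k::{alg_closed_field, field_char_0} \<Rightarrow> 'a::ring_1 \<Rightarrow> 'a"
    and \<Delta> :: "'a \<Rightarrow> ('a \<times> 'a \<Rightarrow>\<^sub>0 'k)"
    and \<epsilon> :: "'a \<Rightarrow> 'k"
    and S :: "'a \<Rightarrow> 'a"
  assumes "hopf_algebra scale \<Delta> \<epsilon> S"
  shows
    "(\<forall>g x y. is_A2 scale \<Delta> g x y \<longrightarrow>
       (let B = [1, g, x, y, g * x, g * y, x * y, g * x * y] in
        is_basis scale B \<and>
        has_values scale B \<epsilon> [1, 1, 0, 0, 0, 0, 0, 0] \<and>
        {lam. partial_action scale \<Delta> lam} =
          {\<epsilon>} \<union>
          {lam. \<exists>\<alpha> \<beta>. has_values scale B lam [1, 0, \<alpha>, \<beta>, \<alpha>, \<beta>, 0, 0]} \<and>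
        (\<forall>lam \<alpha> \<beta>. has_values scale B lam [1, 0, \<alpha>, \<beta>, \<alpha>, \<beta>, 0, 0] \<longrightarrow>
           unit_locus scale \<Delta> lam = {1}))) \<and>
     (\<forall>g x. is_A4' scale \<Delta> g x \<longrightarrow>
       (let B = [1, g, g ^ 2, g ^ 3, x, g * x, g ^ 2 * x, g ^ 3 * x] in
        is_basis scale B \<and>
        has_values scale B \<epsilon> [1, 1, 1, 1, 0, 0, 0, 0] \<and>
        {lam. partial_action scale \<Delta> lam} =
          {\<epsilon>} \<union>
          {lam. \<exists>\<alpha>. has_values scale B lam [1, 0, 1, 0, \<alpha>, \<alpha>, \<alpha>, \<alpha>]} \<union>
          {lam. has_values scale B lam [1, 0, 0, 0, 0, 0, 0, 0]} \<and>
        (\<forall>lam \<alpha>. has_values scale B lam [1, 0, 1, 0, \<alpha>, \<alpha>, \<alpha>, \<alpha>] \<longrightarrow>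
           unit_locus scale \<Delta> lam = {1, g ^ 2}) \<and>
        (\<forall>lam. has_values scale B lam [1, 0, 0, 0, 0, 0, 0, 0] \<longrightarrow>
           unit_locus scale \<Delta> lam = {1}))) \<and>
     (\<forall>g x. is_A4'' scale \<Delta> g x \<longrightarrow>
       (let B = [1, g, g ^ 2, g ^ 3, x, g * x, g ^ 2 * x, g ^ 3 * x] in
        is_basis scale B \<and>
        has_values scale B \<epsilon> [1, 1, 1, 1, 0, 0, 0, 0] \<and>
        {lam. partial_action scale \<Delta> lam} =
          {\<epsilon>} \<union>
          {lam. \<exists>\<alpha>. has_values scale B lam [1, 0, 1, 0, \<alpha>, \<alpha>, \<alpha>, \<alpha>]} \<union>
          {lam. \<exists>\<gamma>. \<gamma> ^ 2 = -1 \<and> has_values scale B lam [1, 0, 0, 0, \<gamma>, 0, 0, \<gamma>]} \<and>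
        (\<forall>lam \<alpha>. has_values scale B lam [1, 0, 1, 0, \<alpha>, \<alpha>, \<alpha>, \<alpha>] \<longrightarrow>
           unit_locus scale \<Delta> lam = {1, g ^ 2}) \<and>
        (\<forall>lam \<gamma>. \<gamma> ^ 2 = -1 \<and> has_values scale B lam [1, 0, 0, 0, \<gamma>, 0, 0, \<gamma>] \<longrightarrow>
           unit_locus scale \<Delta> lam = {1}))) \<and>
     (\<forall>q g x. primitive_root_of_unity 4 q \<and> is_A4''' scale \<Delta> q g x \<longrightarrow>
       (let B = [1, g, g ^ 2, g ^ 3, x, g * x, g ^ 2 * x, g ^ 3 * x] in
        is_basis scale B \<and>
        has_values scale B \<epsilon> [1, 1, 1, 1, 0, 0, 0, 0] \<and>
        {lam. partial_action scale \<Delta> lam} =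
          {\<epsilon>} \<union>
          {lam. \<exists>\<alpha>. has_values scale B lam [1, 0, 0, 0, \<alpha>, 0, \<alpha>, 0]} \<union>
          {lam. has_values scale B lam [1, 0, 1, 0, 0, 0, 0, 0]} \<and>
        (\<forall>lam \<alpha>. has_values scale B lam [1, 0, 0, 0, \<alpha>, 0, \<alpha>, 0] \<longrightarrow>
           unit_locus scale \<Delta> lam = {1}) \<and>
        (\<forall>lam. has_values scale B lam [1, 0, 1, 0, 0, 0, 0, 0] \<longrightarrow>
           unit_locus scale \<Delta> lam = {1, g ^ 2}))) \<and>
     (\<forall>g h x. is_A22 scale \<Delta> g h x \<longrightarrow>
       (let B = [1, g, h, g * h, x, g * x, h * x, g * h * x] in
        is_basis scale B \<and>
        has_values scale B \<epsilon> [1, 1, 1, 1, 0, 0, 0, 0] \<and>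
        {lam. partial_action scale \<Delta> lam} =
          {\<epsilon>} \<union>
          {lam. \<exists>\<alpha>. has_values scale B lam [1, 0, 0, 0, \<alpha>, \<alpha>, 0, 0]} \<union>
          {lam. \<exists>\<alpha>. has_values scale B lam [1, 0, 0, 1, \<alpha>, \<alpha>, \<alpha>, \<alpha>]} \<union>
          {lam. has_values scale B lam [1, 0, 1, 0, 0, 0, 0, 0]} \<union>
          {lam. has_values scale B lam [1, 1, 0, 0, 0, 0, 0, 0]} \<and>
        (\<forall>lam \<alpha>. has_values scale B lam [1, 0, 0, 0, \<alpha>, \<alpha>, 0, 0] \<longrightarrow>
           unit_locus scale \<Delta> lam = {1}) \<and>
        (\<forall>lam \<alpha>. has_values scale B lam [1, 0, 0, 1, \<alpha>, \<alpha>, \<alpha>, \<alpha>] \<longrightarrow>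
           unit_locus scale \<Delta> lam = {1, g * h}) \<and>
        (\<forall>lam. has_values scale B lam [1, 0, 1, 0, 0, 0, 0, 0] \<longrightarrow>
           unit_locus scale \<Delta> lam = {1, h}) \<and>
        (\<forall>lam. has_values scale B lam [1, 1, 0, 0, 0, 0, 0, 0] \<longrightarrow>
           unit_locus scale \<Delta> lam = {1, g})))"
proof -
  interpret hopf_algebra scale \<Delta> \<epsilon> S by fact
  show ?thesis
  proof (intro conjI allI impI, goal_cases)
    case (1 g x y)
    then show ?case unfolding Let_def by (rule A2_partial_actions)
  next
    case (2 g x)
    then show ?case unfolding Let_def using A4'_A4''_partial_actions[of 0 g x] by simp
  next
    case (3 g x)
    then show ?case unfolding Let_def using A4'_A4''_partial_actions[of 1 g x] by simp
  next
    case (4 q g x)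
    show ?case unfolding Let_def by (rule A4q_partial_actions) (use 4 in blast)+
  next
    case (5 g h x)
    then show ?case unfolding Let_def by (rule A22_partial_actions) simp
  qed
qed

end
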